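(* Let $\Gamma$ be a uniform lattice in $\mathrm{PGL}_3(\mathbb Q_p)$, let $M=\mathbb P(\mathbb Q_p^3)$, and let $\rho_0:\Gamma\to\mathrm{Homeo}(M)$ be the standard action. For $\epsilon>0$ let $\rho_\epsilon:\Gamma\to\mathrm{Homeo}(M)$ be the action $\rho_\epsilon(\gamma)=h_\epsilon\circ\hat\rho(\gamma)\circ h_\epsilon^{-1}$ built from the blown-up space $\hat M$ as described in the context. Then $\rho_0$ is not conjugate to $\rho_\epsilon$ for any $\epsilon>0$; that is, for no $\epsilon>0$ is there a homeomorphism $f:M\to M$ with $f\circ\rho_\epsilon(\gamma)=\rho_0(\gamma)\circ f$ for all $\gamma\in\Gamma$.
   Context: Let $p$ be a prime, $G=\mathrm{PGL}_3(\mathbb Q_p)$ acting on $M=\mathbb P(\mathbb Q_p^3)$. For $z\in M$, let $L(z)$ be the space of two-dimensional linear subspaces of $\mathbb Q_p^3$ containing $z$, and let $M_z=\{(w,\ell)\in M\times L(z):w\subset\ell\}$ be the blowup of $M$ at $z$, with projection $\pi_z:M_z\to M$, $(w,\ell)\mapsto w$. Each $g\in G$ induces a homeomorphism $g:M_z\to M_{gz}$ with $\pi_{gz}\circ g=g\circ\pi_z$. Fix $z_0\in M$ with trivial $\Gamma$-stabilizer (such points exist) and let $Z=\Gamma z_0$. Let $$\hat M=\Big\{(x_z)\in\prod_{z\in Z}M_z:\ \pi_z(x_z)=\pi_y(x_y)\ \ \forall y,z\in Z\Big\}$$ with the subspace topology of the product, and let $\hat\pi:\hat M\to M$ be the common value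 $\pi_z(x_z)$. The group $\Gamma$ acts on $\hat M$ by $(\hat\rho(\gamma)x)_{\gamma z}=\gamma(x_z)$, giving $\hat\rho:\Gamma\to\mathrm{Homeo}(\hat M)$ with $\hat\pi\circ\hat\rho(\gamma)=\rho_0(\gamma)\circ\hat\pi$. Fix a metric $d$ on $M$ compatible with its topology. For each $\epsilon>0$, $h_\epsilon:\hat M\to M$ is a homeomorphism with $d(h_\epsilon(x),\hat\pi(x))<\epsilon$ for all $x\in\hat M$ (such homeomorphisms exist). *)

theory Defs
  imports
    "HOL-Analysis.Analysis"
    "HOL-Algebra.Coset"
    "HOL-Computational_Algebra.Primes"
begin

section \<open>The field of p-adic numbers\<close>

subsection \<open>The p-adic absolute value on the rationals\<close>

definition padic_abs :: "nat \<Rightarrow> rat \<Rightarrow> real" where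
  "padic_abs p q =
     (if q = 0 then 0
      else real p powi (int (multiplicity (int p) (snd (quotient_of q)))
                        - int (multiplicity (int p) (fst (quotient_of q)))))"

lemma padic_abs_0 [simp]: "padic_abs p 0 = 0"
  by (simp add: padic_abs_def)

lemma padic_abs_divide:
  assumes "prime p" "a \<noteq> 0" "b \<noteq> 0"
  shows "padic_abs p (of_int a / of_int b)
         = real p powi (int (multiplicity (int p) b) - int (multiplicity (int p) a))"
proof -
  obtain c d where cd: "quotient_of (of_int a / of_int b) = (c, d)"
    by fastforce
  have d: "d > 0" using quotient_of_denom_pos[OF cd] .
  have "(of_int a / of_int b :: rat) = of_int c / of_int d"
    using quotient_of_div[OF cd] .
  then have "(of_int (a * d) :: rat) = of_int (c * b)"
    using assms d by (simp add: field_simps)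
  then have eq: "a * d = c * b" by (simp only: of_int_eq_iff)
  then have c: "c \<noteq> 0" using assms d by auto
  have "prime_elem (int p)" using assms by simp
  from prime_elem_multiplicity_mult_distrib[OF this, of a d]
    prime_elem_multiplicity_mult_distrib[OF this, of c b] eq c d assms
  have "int (multiplicity (int p) d) - int (multiplicity (int p) c)
        = int (multiplicity (int p) b) - int (multiplicity (int p) a)"
    by simp
  then show ?thesis using assms cd by (simp add: padic_abs_def)
qed

lemma rat_common_denominator:
  fixes x y :: rat
  obtains a b d :: int where "x = of_int a / of_int d" "y = of_int b / of_int d" "d > 0"
proof -
  obtain a b where x: "x = of_int a / of_int b" "b > 0"
    by (metis quotient_of_denom_pos quotient_of_div surj_pair)
  obtain c d where y: "y = of_int c / of_int d" "d > 0"
    by (metis quotient_of_denom_pos quotient_of_div surj_pair)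
  show thesis
    by (rule that[of "a * d" "b * d" "c * b"]) (use x y in \<open>auto simp: field_simps\<close>)
qed

lemma padic_abs_pos: "prime p \<Longrightarrow> q \<noteq> 0 \<Longrightarrow> padic_abs p q > 0"
  by (simp add: padic_abs_def prime_gt_0_nat)

lemma padic_abs_nonneg [simp]: "padic_abs p q \<ge> 0"
  by (simp add: padic_abs_def)

lemma padic_abs_eq_0 [simp]: "prime p \<Longrightarrow> padic_abs p q = 0 \<longleftrightarrow> q = 0"
  by (metis padic_abs_pos less_irrefl padic_abs_0)

lemma padic_abs_1 [simp]: "padic_abs p 1 = 1"
  by (simp add: padic_abs_def)

lemma padic_abs_mult:
  assumes "prime p"
  shows "padic_abs p (x * y) = padic_abs p x * padic_abs p y"
proof (cases "x = 0 \<or> y = 0")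
  case False
  obtain a b d where abd: "x = of_int a / of_int d" "y = of_int b / of_int d" "d > 0"
    by (rule rat_common_denominator)
  then have nz: "a \<noteq> 0" "b \<noteq> 0" "d \<noteq> 0" using False by auto
  have xy: "x * y = of_int (a * b) / of_int (d * d)" using abd by simp
  have pe: "prime_elem (int p)" and p0: "real p \<noteq> 0"
    using assms by (auto dest: prime_gt_0_nat)
  show ?thesis
    unfolding xy unfolding abd
    using nz prime_elem_multiplicity_mult_distrib[OF pe, of a b]
      prime_elem_multiplicity_mult_distrib[OF pe, of d d] p0
    by (simp add: padic_abs_divide[OF assms] del: of_int_mult
        flip: power_int_add) (simp add: algebra_simps)
qed auto

lemma padic_abs_minus [simp]: "padic_abs p (- x) = padic_abs p x"
proof -
  have "multiplicity (int p) (- a) = multiplicity (int p) a" for a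
    using multiplicity_times_unit_right[of "- 1" "int p" a] by simp
  then show ?thesis by (simp add: padic_abs_def rat_uminus_code split: prod.splits)
qed

lemma padic_abs_minus_commute: "padic_abs p (x - y) = padic_abs p (y - x)"
  by (metis minus_diff_eq padic_abs_minus)

lemma padic_abs_inverse:
  assumes "prime p"
  shows "padic_abs p (inverse x) = inverse (padic_abs p x)"
proof (cases "x = 0")
  case False
  then have "padic_abs p x * padic_abs p (inverse x) = 1"
    by (simp flip: padic_abs_mult[OF assms])
  then show ?thesis by (metis inverse_unique)
qed auto

lemma padic_abs_add_le:
  assumes "prime p"
  shows "padic_abs p (x + y) \<le> max (padic_abs p x) (padic_abs p y)"
proof (cases "x = 0 \<or> y = 0 \<or> x + y = 0")
  case False
  obtain a b d where abd: "x = of_int a / of_int d" "y = of_int b / of_int d" "d > 0"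
    by (rule rat_common_denominator)
  then have nz: "a \<noteq> 0" "b \<noteq> 0" "d \<noteq> 0" using False by auto
  have xy: "x + y = of_int (a + b) / of_int d" using abd by (simp add: add_divide_distrib)
  then have nz': "a + b \<noteq> 0" using False by auto
  define m where "m = min (multiplicity (int p) a) (multiplicity (int p) b)"
  have "int p ^ m dvd a + b"
    by (intro dvd_add multiplicity_dvd') (auto simp: m_def)
  moreover have "\<not> is_unit (int p)" using assms by (auto dest: prime_gt_1_nat)
  ultimately have m: "m \<le> multiplicity (int p) (a + b)"
    using nz' by (intro multiplicity_geI) auto
  have p1: "real p \<ge> 1" using prime_gt_1_nat[OF assms] by simp
  have "padic_abs p (x + y) \<le> real p powi (int (multiplicity (int p) d) - int m)"
    unfolding xy padic_abs_divide[OF assms nz' nz(3)]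
    using m p1 by (intro power_int_increasing) auto
  also have "\<dots> \<le> max (padic_abs p x) (padic_abs p y)"
    unfolding abd padic_abs_divide[OF assms nz(1) nz(3)] padic_abs_divide[OF assms nz(2) nz(3)]
    by (auto simp: m_def min_def)
  finally show ?thesis .
qed (auto simp: add_eq_0_iff)

lemma padic_abs_triangle: "prime p \<Longrightarrow> padic_abs p (x + y) \<le> padic_abs p x + padic_abs p y"
  using padic_abs_add_le[of p x y] padic_abs_nonneg[of p x] padic_abs_nonneg[of p y] by linarith

lemma padic_abs_diff_triangle:
  "prime p \<Longrightarrow> padic_abs p (x - z) \<le> padic_abs p (x - y) + padic_abs p (y - z)"
  using padic_abs_triangle[of p "x - y" "y - z"] by simp

lemma padic_abs_abs_diff: "prime p \<Longrightarrow> \<bar>padic_abs p x - padic_abs p y\<bar> \<le> padic_abs p (x - y)"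
  using padic_abs_triangle[of p "x - y" y] padic_abs_triangle[of p "y - x" x]
    padic_abs_minus_commute[of p x y]
  by simp

subsection \<open>Cauchy sequences and null sequences\<close>

definition padic_cauchy :: "nat \<Rightarrow> (nat \<Rightarrow> rat) \<Rightarrow> bool" where
  "padic_cauchy p X \<longleftrightarrow> (\<forall>e>0. \<exists>N. \<forall>m\<ge>N. \<forall>n\<ge>N. padic_abs p (X m - X n) < e)"

definition padic_null :: "nat \<Rightarrow> (nat \<Rightarrow> rat) \<Rightarrow> bool" where
  "padic_null p X \<longleftrightarrow> (\<lambda>n. padic_abs p (X n)) \<longlonglongrightarrow> 0"

lemma padic_cauchy_const [simp]: "padic_cauchy p (\<lambda>n. c)"
  by (simp add: padic_cauchy_def)

lemma padic_null_const [simp]: "prime p \<Longrightarrow> padic_null p (\<lambda>n. c) \<longleftrightarrow> c = 0"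
  by (simp add: padic_null_def LIMSEQ_const_iff)

lemma padic_null_minus: "padic_null p X \<Longrightarrow> padic_null p (\<lambda>n. - X n)"
  by (simp add: padic_null_def)

lemma padic_null_add:
  assumes "prime p" "padic_null p X" "padic_null p Y"
  shows "padic_null p (\<lambda>n. X n + Y n)"
proof -
  have "(\<lambda>n. padic_abs p (X n) + padic_abs p (Y n)) \<longlonglongrightarrow> 0"
    using tendsto_add[of "\<lambda>n. padic_abs p (X n)" 0 _ "\<lambda>n. padic_abs p (Y n)" 0] assms
    by (simp add: padic_null_def)
  then show ?thesis
    unfolding padic_null_def
    by (rule Lim_null_comparison[rotated])
      (auto intro!: always_eventually padic_abs_triangle assms)
qed

lemma padic_cauchy_minus: "padic_cauchy p X \<Longrightarrow> padic_cauchy p (\<lambda>n. - X n)"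
  by (simp add: padic_cauchy_def) (metis (no_types) padic_abs_minus_commute)

lemma padic_cauchy_add:
  assumes "prime p" "padic_cauchy p X" "padic_cauchy p Y"
  shows "padic_cauchy p (\<lambda>n. X n + Y n)"
  unfolding padic_cauchy_def
proof (intro allI impI)
  fix e :: real assume e: "e > 0"
  obtain M where M: "\<And>m n. m \<ge> M \<Longrightarrow> n \<ge> M \<Longrightarrow> padic_abs p (X m - X n) < e"
    using assms e unfolding padic_cauchy_def by meson
  obtain N where N: "\<And>m n. m \<ge> N \<Longrightarrow> n \<ge> N \<Longrightarrow> padic_abs p (Y m - Y n) < e"
    using assms e unfolding padic_cauchy_def by meson
  have "padic_abs p (X m + Y m - (X n + Y n)) < e" if "m \<ge> max M N" "n \<ge> max M N" for m n
  proof -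
    have eq: "X m + Y m - (X n + Y n) = (X m - X n) + (Y m - Y n)" by simp
    have "max (padic_abs p (X m - X n)) (padic_abs p (Y m - Y n)) < e"
      using M[of m n] N[of m n] that by simp
    then show ?thesis
      unfolding eq by (rule le_less_trans[OF padic_abs_add_le[OF assms(1)]])
  qed
  then show "\<exists>N. \<forall>m\<ge>N. \<forall>n\<ge>N. padic_abs p (X m + Y m - (X n + Y n)) < e" by blast
qed

lemma padic_cauchy_bounded:
  assumes "prime p" "padic_cauchy p X"
  obtains B where "B > 0" "\<And>n. padic_abs p (X n) \<le> B"
proof -
  obtain N where N: "\<And>m n. m \<ge> N \<Longrightarrow> n \<ge> N \<Longrightarrow> padic_abs p (X m - X n) < 1"
    using assms unfolding padic_cauchy_def by (meson zero_less_one)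
  define B where "B = 1 + (\<Sum>n\<le>N. padic_abs p (X n))"
  have "padic_abs p (X n) \<le> B" for n
  proof (cases "n \<le> N")
    case True
    then have "padic_abs p (X n) \<le> (\<Sum>n\<le>N. padic_abs p (X n))"
      by (intro member_le_sum) auto
    then show ?thesis by (simp add: B_def)
  next
    case False
    have "padic_abs p (X N) \<le> (\<Sum>n\<le>N. padic_abs p (X n))"
      by (intro member_le_sum) auto
    moreover have "padic_abs p (X n) \<le> padic_abs p (X n - X N) + padic_abs p (X N)"
      using padic_abs_triangle[OF assms(1), of "X n - X N" "X N"] by simp
    ultimately show ?thesis using N[of n N] False by (simp add: B_def)
  qed
  moreover have "B > 0" by (auto simp: B_def intro!: add_pos_nonneg sum_nonneg)
  ultimately show thesis using that by blast
qed

lemma padic_null_mult_bounded: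
  assumes "prime p" "padic_cauchy p X" "padic_null p Y"
  shows "padic_null p (\<lambda>n. X n * Y n)"
proof -
  obtain B where B: "B > 0" "\<And>n. padic_abs p (X n) \<le> B"
    using padic_cauchy_bounded[OF assms(1,2)] by blast
  have "(\<lambda>n. B * padic_abs p (Y n)) \<longlonglongrightarrow> 0"
    using assms(3) unfolding padic_null_def by (rule tendsto_mult_right_zero)
  then show ?thesis
    unfolding padic_null_def
    by (rule Lim_null_comparison[rotated])
      (auto intro!: always_eventually mult_right_mono B simp: padic_abs_mult[OF assms(1)])
qed

lemma padic_cauchy_mult:
  assumes "prime p" "padic_cauchy p X" "padic_cauchy p Y"
  shows "padic_cauchy p (\<lambda>n. X n * Y n)"
  unfolding padic_cauchy_def
proof (intro allI impI)
  fix e :: real assume e: "e > 0"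
  obtain A where A: "A > 0" "\<And>n. padic_abs p (X n) \<le> A"
    using padic_cauchy_bounded[OF assms(1,2)] by blast
  obtain B where B: "B > 0" "\<And>n. padic_abs p (Y n) \<le> B"
    using padic_cauchy_bounded[OF assms(1,3)] by blast
  obtain M where M: "\<And>m n. m \<ge> M \<Longrightarrow> n \<ge> M \<Longrightarrow> padic_abs p (X m - X n) < e / B"
    using assms e B unfolding padic_cauchy_def by (meson divide_pos_pos)
  obtain N where N: "\<And>m n. m \<ge> N \<Longrightarrow> n \<ge> N \<Longrightarrow> padic_abs p (Y m - Y n) < e / A"
    using assms e A unfolding padic_cauchy_def by (meson divide_pos_pos)
  have "padic_abs p (X m * Y m - X n * Y n) < e" if mn: "m \<ge> max M N" "n \<ge> max M N" for m n
  proof -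
    have "X m * Y m - X n * Y n = X m * (Y m - Y n) + (X m - X n) * Y n"
      by (simp add: algebra_simps)
    moreover have "padic_abs p (X m * (Y m - Y n)) < e"
    proof -
      have "padic_abs p (X m * (Y m - Y n)) \<le> A * padic_abs p (Y m - Y n)"
        by (auto simp: padic_abs_mult[OF assms(1)] intro!: mult_right_mono A)
      also have "\<dots> < e" using N[of m n] mn A(1) by (simp add: field_simps)
      finally show ?thesis .
    qed
    moreover have "padic_abs p ((X m - X n) * Y n) < e"
    proof -
      have "padic_abs p ((X m - X n) * Y n) \<le> padic_abs p (X m - X n) * B"
        by (auto simp: padic_abs_mult[OF assms(1)] intro!: mult_left_mono B)
      also have "\<dots> < e" using M[of m n] mn B(1) by (simp add: field_simps)
      finally show ?thesis .
    qed
    ultimately show ?thesis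
      using padic_abs_add_le[OF assms(1), of "X m * (Y m - Y n)" "(X m - X n) * Y n"] by simp
  qed
  then show "\<exists>N. \<forall>m\<ge>N. \<forall>n\<ge>N. padic_abs p (X m * Y m - X n * Y n) < e" by blast
qed

lemma padic_cauchy_not_null:
  assumes "prime p" "padic_cauchy p X" "\<not> padic_null p X"
  obtains c N where "c > 0" "\<And>n. n \<ge> N \<Longrightarrow> padic_abs p (X n) \<ge> c"
proof -
  obtain e where e: "e > 0" "\<And>N. \<exists>n\<ge>N. padic_abs p (X n) \<ge> e"
    using assms(3) unfolding padic_null_def LIMSEQ_iff by (auto simp: not_less)
  obtain N where N: "\<And>m n. m \<ge> N \<Longrightarrow> n \<ge> N \<Longrightarrow> padic_abs p (X m - X n) < e / 2"
    using assms e unfolding padic_cauchy_def by (meson half_gt_zero)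
  obtain k where k: "k \<ge> N" "padic_abs p (X k) \<ge> e" using e by blast
  have "padic_abs p (X n) \<ge> e / 2" if "n \<ge> N" for n
    using padic_abs_triangle[OF assms(1), of "X k - X n" "X n"] N[of k n] k that by simp
  then show thesis using that[of "e / 2" N] e by simp
qed

lemma padic_cauchy_inverse:
  assumes "prime p" "padic_cauchy p X" "\<not> padic_null p X"
  shows "padic_cauchy p (\<lambda>n. inverse (X n))"
  unfolding padic_cauchy_def
proof (intro allI impI)
  fix e :: real assume e: "e > 0"
  obtain c N where c: "c > 0" "\<And>n. n \<ge> N \<Longrightarrow> padic_abs p (X n) \<ge> c"
    using padic_cauchy_not_null[OF assms] by blast
  have "e * c * c > 0" using e c by simp
  then obtain M where M: "\<And>m n. m \<ge> M \<Longrightarrow> n \<ge> M \<Longrightarrow> padic_abs p (X m - X n) < e * c * c"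
    using assms(2) unfolding padic_cauchy_def by meson
  have "padic_abs p (inverse (X m) - inverse (X n)) < e"
    if mn: "m \<ge> max M N" "n \<ge> max M N" for m n
  proof -
    have mc: "padic_abs p (X m) \<ge> c" "padic_abs p (X n) \<ge> c" using c mn by auto
    then have nz: "X m \<noteq> 0" "X n \<noteq> 0" using c(1) by auto
    then have eq: "inverse (X m) - inverse (X n) = (X n - X m) * (inverse (X m) * inverse (X n))"
      by (simp add: field_simps)
    have "padic_abs p (inverse (X m) - inverse (X n))
      = padic_abs p (X n - X m) / (padic_abs p (X m) * padic_abs p (X n))"
      unfolding eq
      by (simp add: padic_abs_mult[OF assms(1)] padic_abs_inverse[OF assms(1)] divide_inverse)
    also have "\<dots> \<le> padic_abs p (X n - X m) / (c * c)"
      using mc c(1) by (intro divide_left_mono mult_mono) auto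
    also have "\<dots> < e" using M[of n m] mn c(1) by (simp add: field_simps)
    finally show ?thesis .
  qed
  then show "\<exists>N. \<forall>m\<ge>N. \<forall>n\<ge>N. padic_abs p (inverse (X m) - inverse (X n)) < e" by blast
qed

lemma padic_null_inverse_diff:
  assumes "prime p" "padic_cauchy p X" "\<not> padic_null p X" "padic_cauchy p Y" "\<not> padic_null p Y"
    and "padic_null p (\<lambda>n. X n - Y n)"
  shows "padic_null p (\<lambda>n. inverse (X n) - inverse (Y n))"
proof -
  obtain c N where c: "c > 0" "\<And>n. n \<ge> N \<Longrightarrow> padic_abs p (X n) \<ge> c"
    using padic_cauchy_not_null[OF assms(1-3)] by blast
  obtain d M where d: "d > 0" "\<And>n. n \<ge> M \<Longrightarrow> padic_abs p (Y n) \<ge> d"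
    using padic_cauchy_not_null[OF assms(1,4,5)] by blast
  have *: "padic_null p (\<lambda>n. inverse (X n) * inverse (Y n) * (- (X n - Y n)))"
    using assms by (intro padic_null_mult_bounded padic_cauchy_mult padic_cauchy_inverse padic_null_minus)
  have "inverse (X n) * inverse (Y n) * (- (X n - Y n)) = inverse (X n) - inverse (Y n)"
    if "n \<ge> max M N" for n
  proof -
    have "X n \<noteq> 0" "Y n \<noteq> 0" using c(1) c(2)[of n] d(1) d(2)[of n] that by auto
    then show ?thesis by (simp add: field_simps)
  qed
  then have "eventually (\<lambda>n. padic_abs p (inverse (X n) * inverse (Y n) * (- (X n - Y n)))
      = padic_abs p (inverse (X n) - inverse (Y n))) sequentially"
    by (metis (mono_tags, lifting) eventually_sequentially)
  from Lim_transform_eventually[OF *[unfolded padic_null_def] this]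
  show ?thesis unfolding padic_null_def .
qed

lemma padic_cauchy_convergent_abs:
  assumes "prime p" "padic_cauchy p X"
  shows "convergent (\<lambda>n. padic_abs p (X n))"
proof -
  have "Cauchy (\<lambda>n. padic_abs p (X n))"
    unfolding Cauchy_def dist_real_def
    using assms padic_abs_abs_diff[OF assms(1)] unfolding padic_cauchy_def
    by (meson le_less_trans)
  then show ?thesis by (simp add: Cauchy_convergent_iff)
qed

subsection \<open>The type of p-adic numbers\<close>

text \<open>The prime is carried by an index type \<open>'p\<close>, of which only the cardinality
  \<open>p = CARD('p)\<close> matters. \<open>'p padic\<close> is the completion of the rationals for the
  \<open>p\<close>-adic absolute value: Cauchy sequences modulo null sequences.\<close>

class prime_card =
  assumes prime_card: "prime CARD('a)"

instance bool :: prime_card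
  by standard simp

definition padic_rel :: "'p::prime_card itself \<Rightarrow> (nat \<Rightarrow> rat) \<Rightarrow> (nat \<Rightarrow> rat) \<Rightarrow> bool" where
  "padic_rel _ X Y \<longleftrightarrow>
     padic_cauchy CARD('p) X \<and> padic_cauchy CARD('p) Y \<and> padic_null CARD('p) (\<lambda>n. X n - Y n)"

lemma padic_rel_sym: "padic_rel T X Y \<Longrightarrow> padic_rel T Y X"
  by (auto simp: padic_rel_def padic_null_def padic_abs_minus_commute)

lemma padic_rel_trans: "padic_rel T X Y \<Longrightarrow> padic_rel T Y Z \<Longrightarrow> padic_rel T X Z"
  unfolding padic_rel_def by (force dest: padic_null_add[OF prime_card])

lemma padic_rel_refl [simp]: "padic_rel TYPE('p::prime_card) X X \<longleftrightarrow> padic_cauchy CARD('p) X"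
  by (simp add: padic_rel_def prime_card)

text \<open>The quotient is set up by hand because \<open>quotient_type\<close> does not handle partial equivalence
  relations that depend on a phantom type parameter.\<close>

typedef (overloaded) 'p padic =
  "{C. \<exists>X. padic_cauchy CARD('p::prime_card) X \<and> C = {Y. padic_rel TYPE('p) X Y}}"
  by (blast intro: padic_cauchy_const)

definition Padic :: "(nat \<Rightarrow> rat) \<Rightarrow> 'p::prime_card padic" where
  "Padic X = Abs_padic {Y. padic_rel TYPE('p) X Y}"

definition rep_padic :: "'p::prime_card padic \<Rightarrow> nat \<Rightarrow> rat" where
  "rep_padic x = (SOME X. X \<in> Rep_padic x)"

definition cr_padic :: "(nat \<Rightarrow> rat) \<Rightarrow> 'p::prime_card padic \<Rightarrow> bool" where
  "cr_padic X y \<longleftrightarrow> padic_rel TYPE('p) X X \<and> Padic X = y"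

lemma Padic_cases [cases type: padic]:
  fixes x :: "'p::prime_card padic"
  obtains X where "padic_cauchy CARD('p) X" "x = Padic X"
proof -
  obtain X where X: "padic_cauchy CARD('p) X" "Rep_padic x = {Y. padic_rel TYPE('p) X Y}"
    using Rep_padic[of x] by auto
  then have "x = Padic X" unfolding Padic_def by (metis Rep_padic_inverse)
  with X show thesis using that by blast
qed

lemma eq_Padic_rel:
  assumes "padic_cauchy CARD('p) X" "padic_cauchy CARD('p) Y"
  shows "(Padic X :: 'p::prime_card padic) = Padic Y \<longleftrightarrow> padic_rel TYPE('p) X Y"
proof -
  have "(Padic X :: 'p padic) = Padic Y
      \<longleftrightarrow> {Z. padic_rel TYPE('p) X Z} = {Z. padic_rel TYPE('p) Y Z}"
    unfolding Padic_def using assms by (subst Abs_padic_inject) auto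
  also have "\<dots> \<longleftrightarrow> padic_rel TYPE('p) X Y"
    using assms(2) padic_rel_sym padic_rel_trans padic_rel_refl by blast
  finally show ?thesis .
qed

lemma padic_cauchy_rep: "padic_cauchy CARD('p) (rep_padic (x :: 'p::prime_card padic))"
  and Padic_rep: "Padic (rep_padic x) = x"
proof -
  obtain X where X: "padic_cauchy CARD('p) X" "x = Padic X" by (cases x)
  then have R: "Rep_padic x = {Y. padic_rel TYPE('p) X Y}"
    unfolding Padic_def by (subst X(2), subst Padic_def, subst Abs_padic_inverse) auto
  have "X \<in> Rep_padic x" using X(1) R by simp
  then have "rep_padic x \<in> Rep_padic x" unfolding rep_padic_def by (rule someI[of "\<lambda>X. X \<in> Rep_padic x"])
  then have rel: "padic_rel TYPE('p) X (rep_padic x)" using R by simp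
  then show c: "padic_cauchy CARD('p) (rep_padic x)" by (simp add: padic_rel_def)
  show "Padic (rep_padic x) = x"
    using rel eq_Padic_rel[OF X(1) c] X(2) by simp
qed

lemma Quotient_padic:
  "Quotient (padic_rel TYPE('p::prime_card)) (Padic :: _ \<Rightarrow> 'p padic) rep_padic cr_padic"
proof (rule QuotientI)
  fix x :: "'p padic" and X Y :: "nat \<Rightarrow> rat"
  show "Padic (rep_padic x) = x" by (rule Padic_rep)
  show "padic_rel TYPE('p) (rep_padic x) (rep_padic x)" by (simp add: padic_cauchy_rep)
  show "padic_rel TYPE('p) X Y \<longleftrightarrow> padic_rel TYPE('p) X X \<and> padic_rel TYPE('p) Y Y
      \<and> (Padic X :: 'p padic) = Padic Y"
  proof (cases "padic_cauchy CARD('p) X \<and> padic_cauchy CARD('p) Y")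
    case True
    then show ?thesis by (simp add: eq_Padic_rel)
  next
    case False
    then have "\<not> padic_rel TYPE('p) X Y" by (auto simp: padic_rel_def)
    then show ?thesis using False by auto
  qed
  show "cr_padic = (\<lambda>X y. padic_rel TYPE('p) X X \<and> (Padic X :: 'p padic) = y)"
    by (intro ext) (rule cr_padic_def)
qed

setup_lifting Quotient_padic

lemma eq_Padic:
  "padic_cauchy CARD('p) X \<Longrightarrow> padic_cauchy CARD('p) Y \<Longrightarrow>
   (Padic X :: 'p::prime_card padic) = Padic Y \<longleftrightarrow> padic_null CARD('p) (\<lambda>n. X n - Y n)"
  by (simp add: eq_Padic_rel) (simp add: padic_rel_def)

instantiation padic :: (prime_card) field
begin

lift_definition zero_padic :: "'a padic" is "\<lambda>n. 0" by simp

lift_definition one_padic :: "'a padic" is "\<lambda>n. 1" by simp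

lift_definition plus_padic :: "'a padic \<Rightarrow> 'a padic \<Rightarrow> 'a padic" is "\<lambda>X Y n. X n + Y n"
  unfolding padic_rel_def add_diff_add
  by (simp add: padic_cauchy_add padic_null_add prime_card)

lift_definition uminus_padic :: "'a padic \<Rightarrow> 'a padic" is "\<lambda>X n. - X n"
  unfolding padic_rel_def minus_diff_minus
  by (simp only: padic_cauchy_minus padic_null_minus simp_thms)

lift_definition times_padic :: "'a padic \<Rightarrow> 'a padic \<Rightarrow> 'a padic" is "\<lambda>X Y n. X n * Y n"
proof -
  fix X X' Y Y' :: "nat \<Rightarrow> rat"
  assume "padic_rel TYPE('a) X X'" "padic_rel TYPE('a) Y Y'"
  then have *: "padic_cauchy CARD('a) X" "padic_cauchy CARD('a) X'" "padic_cauchy CARD('a) Y"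
    "padic_cauchy CARD('a) Y'" "padic_null CARD('a) (\<lambda>n. X n - X' n)"
    "padic_null CARD('a) (\<lambda>n. Y n - Y' n)"
    by (auto simp: padic_rel_def)
  then have "padic_null CARD('a) (\<lambda>n. X n * (Y n - Y' n) + Y' n * (X n - X' n))"
    by (intro padic_null_add padic_null_mult_bounded prime_card) auto
  then show "padic_rel TYPE('a) (\<lambda>n. X n * Y n) (\<lambda>n. X' n * Y' n)"
    using * by (simp add: padic_rel_def padic_cauchy_mult prime_card algebra_simps)
qed

lift_definition inverse_padic :: "'a padic \<Rightarrow> 'a padic"
  is "\<lambda>X. if padic_null CARD('a) X then (\<lambda>n. 0) else (\<lambda>n. inverse (X n))"
proof -
  fix X Y :: "nat \<Rightarrow> rat"
  assume "padic_rel TYPE('a) X Y"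
  then have *: "padic_cauchy CARD('a) X" "padic_cauchy CARD('a) Y"
    "padic_null CARD('a) (\<lambda>n. X n - Y n)"
    by (auto simp: padic_rel_def)
  have "padic_null CARD('a) X \<longleftrightarrow> padic_null CARD('a) Y"
    using padic_null_add[OF prime_card *(3), of Y]
      padic_null_add[OF prime_card _ padic_null_minus[OF *(3)], of X]
    by auto
  then show "?thesis X Y"
    using * by (simp add: padic_rel_def padic_cauchy_inverse padic_null_inverse_diff prime_card)
qed

definition "x - y = x + - y" for x y :: "'a padic"

definition "x div y = x * inverse y" for x y :: "'a padic"

instance
proof
  fix a b c :: "'a padic"
  show "a + b + c = a + (b + c)"
    by transfer (simp add: ac_simps padic_cauchy_add prime_card padic_rel_def)
  show "a + b = b + a"
    by transfer (simp add: ac_simps padic_cauchy_add prime_card padic_rel_def)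
  show "0 + a = a"
    by transfer (simp add: padic_rel_def prime_card)
  show "- a + a = 0"
    by transfer (simp add: padic_rel_def prime_card)
  show "a - b = a + - b"
    by (rule minus_padic_def)
  show "a * b * c = a * (b * c)"
    by transfer (simp add: ac_simps padic_cauchy_mult prime_card padic_rel_def)
  show "a * b = b * a"
    by transfer (simp add: ac_simps padic_cauchy_mult prime_card padic_rel_def)
  show "1 * a = a"
    by transfer (simp add: padic_rel_def prime_card)
  show "(a + b) * c = a * c + b * c"
    by transfer (simp add: distrib_right padic_cauchy_add padic_cauchy_mult prime_card padic_rel_def)
  show "(0::'a padic) \<noteq> 1"
    by transfer (simp add: padic_rel_def prime_card)
  show "a \<noteq> 0 \<Longrightarrow> inverse a * a = 1"
  proof transfer
    fix X :: "nat \<Rightarrow> rat"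
    assume "padic_rel TYPE('a) X X" and "\<not> padic_rel TYPE('a) X (\<lambda>n. 0)"
    then have X: "padic_cauchy CARD('a) X" "\<not> padic_null CARD('a) X"
      by (auto simp: padic_rel_def)
    obtain c N where c: "c > 0" "\<And>n. n \<ge> N \<Longrightarrow> padic_abs CARD('a) (X n) \<ge> c"
      using padic_cauchy_not_null[OF prime_card X] by blast
    have "padic_abs CARD('a) (inverse (X n) * X n - 1) = 0" if "n \<ge> N" for n
    proof -
      have "X n \<noteq> 0" using c(1) c(2)[OF that] by auto
      then show ?thesis by simp
    qed
    then have "padic_null CARD('a) (\<lambda>n. inverse (X n) * X n - 1)"
      unfolding padic_null_def
      by (intro tendsto_eventually) (auto simp: eventually_sequentially)
    then show "padic_rel TYPE('a)
        (\<lambda>n. (if padic_null CARD('a) X then \<lambda>n. 0 else (\<lambda>n. inverse (X n))) n * X n) (\<lambda>n. 1)"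
      using X by (simp add: padic_rel_def padic_cauchy_mult padic_cauchy_inverse prime_card)
  qed
  show "a div b = a * inverse b"
    by (rule divide_padic_def)
  show "inverse (0::'a padic) = 0"
    by transfer (simp add: padic_rel_def prime_card)
qed

end

lemma of_nat_Padic: "(of_nat n :: 'p::prime_card padic) = Padic (\<lambda>_. of_nat n)"
proof (induction n)
  case 0
  then show ?case by (simp add: zero_padic.abs_eq)
next
  case (Suc n)
  then show ?case by (simp add: one_padic.abs_eq plus_padic.abs_eq)
qed

instance padic :: (prime_card) field_char_0
proof
  show "inj (of_nat :: nat \<Rightarrow> 'a padic)"
    by (rule injI) (simp add: of_nat_Padic eq_Padic prime_card)
qed

lemma diff_Padic:
  "padic_cauchy CARD('p) X \<Longrightarrow> padic_cauchy CARD('p) Y \<Longrightarrow>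
   (Padic X :: 'p::prime_card padic) - Padic Y = Padic (\<lambda>n. X n - Y n)"
  by (simp add: minus_padic_def uminus_padic.abs_eq plus_padic.abs_eq padic_cauchy_minus)

lemma of_int_Padic: "(of_int n :: 'p::prime_card padic) = Padic (\<lambda>_. of_int n)"
  by (cases n rule: int_diff_cases) (simp add: of_nat_Padic diff_Padic)

lemma of_rat_Padic: "(of_rat q :: 'p::prime_card padic) = Padic (\<lambda>_. q)"
proof -
  obtain a b where q: "q = of_int a / of_int b" "b > 0"
    by (metis quotient_of_denom_pos quotient_of_div surj_pair)
  have "(Padic (\<lambda>_. q) :: 'p padic) * of_int b = of_int a"
    using q by (simp add: of_int_Padic times_padic.abs_eq)
  moreover have "(of_rat q :: 'p padic) * of_int b = of_int a"
    using q by (simp add: of_rat_divide)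
  ultimately show ?thesis using q(2) by (metis mult_right_cancel of_int_eq_0_iff less_irrefl)
qed

subsection \<open>The p-adic absolute value and the p-adic topology\<close>

lift_definition padic_norm :: "'p::prime_card padic \<Rightarrow> real"
  is "\<lambda>X. lim (\<lambda>n. padic_abs CARD('p) (X n))"
proof -
  fix X Y :: "nat \<Rightarrow> rat"
  assume "padic_rel TYPE('p) X Y"
  then have *: "padic_cauchy CARD('p) X" "padic_cauchy CARD('p) Y"
    "padic_null CARD('p) (\<lambda>n. X n - Y n)"
    by (auto simp: padic_rel_def)
  have Y: "(\<lambda>n. padic_abs CARD('p) (Y n)) \<longlonglongrightarrow> lim (\<lambda>n. padic_abs CARD('p) (Y n))"
    using padic_cauchy_convergent_abs[OF prime_card *(2)] by (simp add: convergent_LIMSEQ_iff)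
  have "(\<lambda>n. padic_abs CARD('p) (X n) - padic_abs CARD('p) (Y n)) \<longlonglongrightarrow> 0"
    using *(3) unfolding padic_null_def
    by (rule Lim_null_comparison[rotated])
      (auto intro!: always_eventually padic_abs_abs_diff prime_card)
  from tendsto_add[OF this Y]
  show "lim (\<lambda>n. padic_abs CARD('p) (X n)) = lim (\<lambda>n. padic_abs CARD('p) (Y n))"
    by (simp add: limI)
qed

lemma padic_norm_Padic:
  "padic_cauchy CARD('p) X \<Longrightarrow>
   (\<lambda>n. padic_abs CARD('p) (X n)) \<longlonglongrightarrow> padic_norm (Padic X :: 'p::prime_card padic)"
  using padic_cauchy_convergent_abs[OF prime_card]
  by (simp add: padic_norm.abs_eq convergent_LIMSEQ_iff)

lemma padic_norm_of_rat: "padic_norm (of_rat q :: 'p::prime_card padic) = padic_abs CARD('p) q"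
  by (simp add: of_rat_Padic padic_norm.abs_eq)

lemma padic_norm_nonneg [simp]: "padic_norm (x :: 'p::prime_card padic) \<ge> 0"
  by (cases x) (auto intro!: LIMSEQ_le_const[OF padic_norm_Padic])

lemma padic_norm_eq_0 [simp]: "padic_norm (x :: 'p::prime_card padic) = 0 \<longleftrightarrow> x = 0"
proof (cases x)
  case (1 X)
  have "padic_norm x = 0 \<longleftrightarrow> padic_null CARD('p) X"
    unfolding padic_null_def using padic_norm_Padic[OF 1(1)] 1(2) by (metis LIMSEQ_unique)
  then show ?thesis using 1 by (simp add: zero_padic.abs_eq eq_Padic)
qed

lemma padic_norm_mult: "padic_norm (x * y :: 'p::prime_card padic) = padic_norm x * padic_norm y"
proof (cases x; cases y)
  fix X Y assume *: "padic_cauchy CARD('p) X" "x = Padic X" "padic_cauchy CARD('p) Y" "y = Padic Y"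
  have xy: "x * y = Padic (\<lambda>n. X n * Y n)" using * by (simp add: times_padic.abs_eq)
  show ?thesis
    using padic_norm_Padic[OF padic_cauchy_mult[OF prime_card *(1) *(3)]]
      tendsto_mult[OF padic_norm_Padic[OF *(1)] padic_norm_Padic[OF *(3)]]
    unfolding xy padic_abs_mult[OF prime_card] using * by (simp add: LIMSEQ_unique)
qed

lemma padic_norm_minus [simp]: "padic_norm (- x :: 'p::prime_card padic) = padic_norm x"
  by (cases x) (simp add: uminus_padic.abs_eq padic_norm.abs_eq padic_cauchy_minus)

lemma padic_norm_add_le:
  "padic_norm (x + y :: 'p::prime_card padic) \<le> max (padic_norm x) (padic_norm y)"
proof (cases x; cases y)
  fix X Y assume *: "padic_cauchy CARD('p) X" "x = Padic X" "padic_cauchy CARD('p) Y" "y = Padic Y"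
  have xy: "x + y = Padic (\<lambda>n. X n + Y n)" using * by (simp add: plus_padic.abs_eq)
  show ?thesis
    unfolding xy
    by (rule LIMSEQ_le[OF padic_norm_Padic[OF padic_cauchy_add[OF prime_card *(1) *(3)]]
          tendsto_max[OF padic_norm_Padic[OF *(1)] padic_norm_Padic[OF *(3)], folded *(2,4)]])
      (auto intro!: padic_abs_add_le prime_card)
qed

instantiation padic :: (prime_card) metric_space
begin

definition "dist x y = padic_norm (x - y)" for x y :: "'a padic"

definition uniformity_padic :: "('a padic \<times> 'a padic) filter" where
  "uniformity_padic = (INF e\<in>{0<..}. principal {(x, y). dist x y < e})"

definition open_padic :: "'a padic set \<Rightarrow> bool" where
  "open_padic U \<longleftrightarrow> (\<forall>x\<in>U. eventually (\<lambda>(x', y). x' = x \<longrightarrow> y \<in> U) uniformity)"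

instance
proof
  fix x y z :: "'a padic"
  show "dist x y = 0 \<longleftrightarrow> x = y" by (simp add: dist_padic_def)
  have "padic_norm (x - y) \<le> max (padic_norm (x - z)) (padic_norm (- (y - z)))"
    using padic_norm_add_le[of "x - z" "- (y - z)"] by simp
  then have "padic_norm (x - y) \<le> max (padic_norm (x - z)) (padic_norm (y - z))"
    by (simp only: padic_norm_minus)
  then show "dist x y \<le> dist x z + dist y z"
    unfolding dist_padic_def using padic_norm_nonneg[of "x - z"] padic_norm_nonneg[of "y - z"]
    by linarith
qed (simp_all add: uniformity_padic_def open_padic_def)

end

lemma padic_of_rat_dense:
  fixes x :: "'p::prime_card padic"
  assumes "e > 0"
  obtains q where "dist x (of_rat q) < e"
proof (cases x)
  case (1 X)
  have e2: "e / 2 > 0" using assms by simp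
  then obtain N where N: "\<And>m n. m \<ge> N \<Longrightarrow> n \<ge> N \<Longrightarrow> padic_abs CARD('p) (X m - X n) < e / 2"
    using 1(1) unfolding padic_cauchy_def by meson
  have c: "padic_cauchy CARD('p) (\<lambda>n. X n - X N)"
    using padic_cauchy_add[OF prime_card 1(1) padic_cauchy_const[of _ "- X N"]] by simp
  have "x - of_rat (X N) = Padic (\<lambda>n. X n - X N)"
    using 1 by (simp add: of_rat_Padic diff_Padic)
  moreover have "padic_norm (Padic (\<lambda>n. X n - X N) :: 'p padic) \<le> e / 2"
    by (rule LIMSEQ_le_const2[OF padic_norm_Padic[OF c]]) (blast intro: less_imp_le N)
  ultimately have "dist x (of_rat (X N)) \<le> e / 2" by (simp add: dist_padic_def)
  then show thesis using that[of "X N"] e2 by simp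
qed

instance padic :: (prime_card) complete_space
proof
  fix x :: "nat \<Rightarrow> 'a padic"
  assume x: "Cauchy x"
  have "\<exists>q. \<forall>n. dist (x n) (of_rat (q n)) < inverse (real (Suc n))"
    by (intro choice allI) (meson padic_of_rat_dense inverse_positive_iff_positive of_nat_0_less_iff zero_less_Suc)
  then obtain q where q: "\<And>n. dist (x n) (of_rat (q n)) < inverse (real (Suc n))" by blast
  have "(\<lambda>n. dist (x n) (of_rat (q n) :: 'a padic)) \<longlonglongrightarrow> 0"
    by (rule Lim_null_comparison[OF _ LIMSEQ_inverse_real_of_nat])
      (use q in \<open>auto intro!: always_eventually intro: less_imp_le simp del: of_nat_Suc\<close>)
  then have d0: "(\<lambda>n. dist (of_rat (q n) :: 'a padic) (x n)) \<longlonglongrightarrow> 0"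
    by (simp add: dist_commute)
  have "Cauchy (\<lambda>n. of_rat (q n) :: 'a padic)"
    unfolding Cauchy_def
  proof (intro allI impI)
    fix e :: real assume e: "e > 0"
    then have e3: "e / 3 > 0" by simp
    obtain M where M: "\<And>m n. m \<ge> M \<Longrightarrow> n \<ge> M \<Longrightarrow> dist (x m) (x n) < e / 3"
      using x e3 unfolding Cauchy_def by meson
    obtain N where N: "\<And>n. n \<ge> N \<Longrightarrow> dist (of_rat (q n)) (x n) < e / 3"
      using d0 e3 unfolding LIMSEQ_iff by fastforce
    have "dist (of_rat (q m)) (of_rat (q n) :: 'a padic) < e" if "m \<ge> max M N" "n \<ge> max M N" for m n
      using M[of m n] N[of m] N[of n] that
        dist_triangle[of "of_rat (q m)" "of_rat (q n)" "x m"]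
        dist_triangle[of "x m" "of_rat (q n)" "x n"]
      by (simp add: dist_commute)
    then show "\<exists>M. \<forall>m\<ge>M. \<forall>n\<ge>M. dist (of_rat (q m)) (of_rat (q n) :: 'a padic) < e" by blast
  qed
  then have c: "padic_cauchy CARD('a) q"
    by (simp add: Cauchy_def padic_cauchy_def dist_padic_def padic_norm_of_rat flip: of_rat_diff)
  have "(\<lambda>n. of_rat (q n)) \<longlonglongrightarrow> (Padic q :: 'a padic)"
  proof (rule metric_LIMSEQ_I)
    fix e :: real assume e: "e > 0"
    then have e2: "e / 2 > 0" by simp
    obtain N where N: "\<And>m n. m \<ge> N \<Longrightarrow> n \<ge> N \<Longrightarrow> padic_abs CARD('a) (q m - q n) < e / 2"
      using c e2 unfolding padic_cauchy_def by meson
    have "dist (of_rat (q n)) (Padic q :: 'a padic) < e" if n: "n \<ge> N" for n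
    proof -
      have cn: "padic_cauchy CARD('a) (\<lambda>m. q n - q m)"
        using padic_cauchy_add[OF prime_card padic_cauchy_const padic_cauchy_minus[OF c], of "q n"]
        by simp
      have "of_rat (q n) - (Padic q :: 'a padic) = Padic (\<lambda>m. q n - q m)"
        using c by (simp add: of_rat_Padic diff_Padic)
      moreover have "padic_norm (Padic (\<lambda>m. q n - q m) :: 'a padic) \<le> e / 2"
        by (rule LIMSEQ_le_const2[OF padic_norm_Padic[OF cn]]) (use n in \<open>blast intro: less_imp_le N\<close>)
      ultimately show ?thesis using e by (simp add: dist_padic_def)
    qed
    then show "\<exists>N. \<forall>n\<ge>N. dist (of_rat (q n)) (Padic q :: 'a padic) < e" by blast
  qed
  then have d1: "(\<lambda>n. dist (of_rat (q n)) (Padic q :: 'a padic)) \<longlonglongrightarrow> 0"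
    by (rule iffD1[OF tendsto_dist_iff])
  have "(\<lambda>n. dist (x n) (Padic q)) \<longlonglongrightarrow> 0"
    by (rule Lim_null_comparison[OF _ tendsto_add_zero[OF d0 d1]])
      (auto intro!: always_eventually dist_triangle3)
  then have "x \<longlonglongrightarrow> Padic q" by (rule iffD2[OF tendsto_dist_iff])
  then show "convergent x" by (auto simp: convergent_def)
qed

section \<open>Quotient topologies\<close>

definition quotient_topology :: "'a topology \<Rightarrow> ('a \<Rightarrow> 'b) \<Rightarrow> 'b topology" where
  "quotient_topology X f =
     topology (\<lambda>U. U \<subseteq> f ` topspace X \<and> openin X {x \<in> topspace X. f x \<in> U})"

lemma openin_quotient_topology:
  "openin (quotient_topology X f) U \<longleftrightarrow> U \<subseteq> f ` topspace X \<and> openin X {x \<in> topspace X. f x \<in> U}"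
proof -
  have "istopology (\<lambda>U. U \<subseteq> f ` topspace X \<and> openin X {x \<in> topspace X. f x \<in> U})"
    unfolding istopology_def
  proof (intro conjI allI impI)
    fix S T
    assume "S \<subseteq> f ` topspace X \<and> openin X {x \<in> topspace X. f x \<in> S}"
      and "T \<subseteq> f ` topspace X \<and> openin X {x \<in> topspace X. f x \<in> T}"
    moreover have "{x \<in> topspace X. f x \<in> S \<inter> T}
        = {x \<in> topspace X. f x \<in> S} \<inter> {x \<in> topspace X. f x \<in> T}" by blast
    ultimately show "S \<inter> T \<subseteq> f ` topspace X" "openin X {x \<in> topspace X. f x \<in> S \<inter> T}"
      by (auto intro: openin_Int)
  next
    fix \<K>
    assume K: "\<forall>K\<in>\<K>. K \<subseteq> f ` topspace X \<and> openin X {x \<in> topspace X. f x \<in> K}"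
    then show "\<Union>\<K> \<subseteq> f ` topspace X" by blast
    have "{x \<in> topspace X. f x \<in> \<Union>\<K>} = (\<Union>K\<in>\<K>. {x \<in> topspace X. f x \<in> K})" by blast
    then show "openin X {x \<in> topspace X. f x \<in> \<Union>\<K>}" using K by auto
  qed
  then show ?thesis by (simp add: quotient_topology_def topology_inverse')
qed

lemma topspace_quotient_topology [simp]: "topspace (quotient_topology X f) = f ` topspace X"
proof
  have "{x \<in> topspace X. f x \<in> f ` topspace X} = topspace X" by blast
  then have "openin (quotient_topology X f) (f ` topspace X)"
    by (simp add: openin_quotient_topology)
  then show "f ` topspace X \<subseteq> topspace (quotient_topology X f)" by (rule openin_subset)
  show "topspace (quotient_topology X f) \<subseteq> f ` topspace X"
    using openin_topspace[of "quotient_topology X f"] unfolding openin_quotient_topology by blast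
qed

lemma quotient_map_quotient_topology: "quotient_map X (quotient_topology X f) f"
  by (auto simp: quotient_map_def openin_quotient_topology)

section \<open>Points and planes in three-dimensional space\<close>

definition proj_plane :: "('k::field ^ 3) set set" where
  "proj_plane = {w. vec.subspace w \<and> vec.dim w = 1}"

definition proj_topology :: "('k::{field, topological_space} ^ 3) set topology" where
  "proj_topology = quotient_topology (top_of_set {v. v \<noteq> 0}) (\<lambda>v. vec.span {v})"

definition planes :: "('k::field ^ 3) set set" where
  "planes = {l. vec.subspace l \<and> vec.dim l = 2}"

definition plane_topology :: "('k::{field, topological_space} ^ 3) set topology" where
  "plane_topology = quotient_topology
     (top_of_set {(u, v). u \<noteq> v \<and> vec.independent {u, v}}) (\<lambda>(u, v). vec.span {u, v})"

lemma topspace_proj_topology [simp]: "topspace proj_topology = proj_plane"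
proof (rule Set.set_eqI)
  fix w :: "('a ^ 3) set"
  show "w \<in> topspace proj_topology \<longleftrightarrow> w \<in> proj_plane"
  proof
    assume "w \<in> topspace proj_topology"
    then obtain v where "v \<noteq> 0" "w = vec.span {v}" by (auto simp: proj_topology_def)
    then show "w \<in> proj_plane"
      by (auto simp: proj_plane_def vec.dim_span vec.dim_eq_card_independent)
  next
    assume w: "w \<in> proj_plane"
    obtain B where B: "B \<subseteq> w" "vec.independent B" "w \<subseteq> vec.span B" "card B = vec.dim w"
      using vec.basis_exists[of w] by blast
    then obtain v where v: "B = {v}" using w by (auto simp: proj_plane_def card_1_singleton_iff)
    have "vec.span B \<subseteq> w" using w B by (intro vec.span_minimal) (auto simp: proj_plane_def)
    then have "w = vec.span {v}" using B v by auto
    moreover have "v \<noteq> 0" using B v by auto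
    ultimately show "w \<in> topspace proj_topology" by (auto simp: proj_topology_def)
  qed
qed

lemma topspace_plane_topology [simp]: "topspace plane_topology = planes"
proof (rule Set.set_eqI)
  fix w :: "('a ^ 3) set"
  show "w \<in> topspace plane_topology \<longleftrightarrow> w \<in> planes"
  proof
    assume "w \<in> topspace plane_topology"
    then obtain u v where uv: "u \<noteq> v" "vec.independent {u, v}" "w = vec.span {u, v}"
      by (auto simp: plane_topology_def)
    then have "vec.dim w = card {u, v}"
      using vec.dim_eq_card_independent[OF uv(2)] by (simp only: vec.dim_span)
    then show "w \<in> planes" using uv by (auto simp: planes_def)
  next
    assume w: "w \<in> planes"
    obtain B where B: "B \<subseteq> w" "vec.independent B" "w \<subseteq> vec.span B" "card B = vec.dim w"
      using vec.basis_exists[of w] by blast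
    then obtain u v where uv: "B = {u, v}" "u \<noteq> v" using w by (auto simp: planes_def card_2_iff)
    have "vec.span B \<subseteq> w" using w B by (intro vec.span_minimal) (auto simp: planes_def)
    then have "w = vec.span {u, v}" using B uv by auto
    then show "w \<in> topspace plane_topology"
      using B uv by (auto simp: plane_topology_def intro!: image_eqI[of _ _ "(u, v)"])
  qed
qed

section \<open>The projective linear group and its lattices\<close>

definition GL3 :: "('k::field ^ 3 ^ 3) monoid" where
  "GL3 = \<lparr>carrier = {A. invertible A}, mult = (**), one = mat 1\<rparr>"

definition scalars3 :: "('k::field ^ 3 ^ 3) set" where
  "scalars3 = {mat c | c. c \<noteq> 0}"

definition PGL3 :: "('k::field ^ 3 ^ 3) set monoid" where
  "PGL3 = GL3 Mod scalars3"

definition PGL3_topology :: "('k::{field, topological_space} ^ 3 ^ 3) set topology" where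
  "PGL3_topology = quotient_topology (top_of_set (carrier GL3)) (\<lambda>A. scalars3 #>\<^bsub>GL3\<^esub> A)"

lemma topspace_PGL3_topology [simp]: "topspace PGL3_topology = carrier PGL3"
  by (simp add: PGL3_topology_def PGL3_def carrier_FactGroup)

text \<open>Discrete and cocompact; finiteness of the covolume is then automatic.\<close>

definition uniform_lattice :: "('a, 'b) monoid_scheme \<Rightarrow> 'a topology \<Rightarrow> 'a set \<Rightarrow> bool" where
  "uniform_lattice G T \<Gamma> \<longleftrightarrow>
     subgroup \<Gamma> G \<and>
     subtopology T \<Gamma> = discrete_topology \<Gamma> \<and>
     compact_space (quotient_topology T (\<lambda>g. g <#\<^bsub>G\<^esub> \<Gamma>))"

text \<open>An element of \<^const>\<open>PGL3\<close> is a coset of proportional matrices, all of which have the same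
  effect on linear subspaces; see \<open>pgl_act_coset\<close> below.\<close>

definition pgl_act :: "('k::field ^ 3 ^ 3) set \<Rightarrow> ('k ^ 3) set \<Rightarrow> ('k ^ 3) set" where
  "pgl_act g V = {A *v v | A v. A \<in> g \<and> v \<in> V}"

lemma mat_mult_left: "mat c ** (A :: 'k::field ^ 3 ^ 3) = (\<chi> i j. c * A $ i $ j)"
  by (simp add: vec_eq_iff matrix_matrix_mult_def mat_def if_distrib[of "\<lambda>x. x * _"] cong: if_cong)

lemma mat_mult_right: "(A :: 'k::field ^ 3 ^ 3) ** mat c = (\<chi> i j. c * A $ i $ j)"
  by (simp add: vec_eq_iff matrix_matrix_mult_def mat_def if_distrib[of "\<lambda>x. _ * x"] mult.commute
      cong: if_cong)

lemma mat_vector_mult: "mat c *v v = c *s (v :: 'k::field ^ 3)"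
  by (simp add: vec_eq_iff matrix_vector_mult_def mat_def if_distrib[of "\<lambda>x. x * _"] cong: if_cong)

lemma mat_mult_mat: "mat c ** mat d = (mat (c * d) :: 'k::field ^ 3 ^ 3)"
  by (simp add: mat_mult_left) (simp add: mat_def vec_eq_iff)

lemma group_GL3: "group (GL3 :: ('k::field ^ 3 ^ 3) monoid)"
proof (rule groupI)
  fix A :: "'k ^ 3 ^ 3"
  assume "A \<in> carrier GL3"
  then obtain B where "A ** B = mat 1" "B ** A = mat 1" by (auto simp: GL3_def invertible_def)
  then show "\<exists>B\<in>carrier GL3. B \<otimes>\<^bsub>GL3\<^esub> A = \<one>\<^bsub>GL3\<^esub>"
    by (auto simp: GL3_def invertible_def)
qed (auto simp: GL3_def invertible_mult matrix_mul_assoc invertible_def[of "mat 1"])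

lemma normal_scalars3: "scalars3 \<lhd> (GL3 :: ('k::field ^ 3 ^ 3) monoid)"
proof -
  interpret group "GL3 :: ('k ^ 3 ^ 3) monoid" by (rule group_GL3)
  have inv: "mat c ** mat (inverse c) = (mat 1 :: 'k ^ 3 ^ 3)"
    "mat (inverse c) ** mat c = (mat 1 :: 'k ^ 3 ^ 3)" if "c \<noteq> 0" for c
    using that by (simp_all add: mat_mult_mat)
  then have carrier: "mat c \<in> carrier (GL3 :: ('k ^ 3 ^ 3) monoid)" if "c \<noteq> 0" for c
    using that by (auto simp: GL3_def invertible_def)
  have inv_eq: "inv\<^bsub>GL3\<^esub> (mat c) = (mat (inverse c) :: 'k ^ 3 ^ 3)" if "c \<noteq> 0" for c
    using that inv[OF that] carrier[of c] carrier[of "inverse c"]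
    by (intro inv_equality) (auto simp: GL3_def)
  have "subgroup scalars3 (GL3 :: ('k ^ 3 ^ 3) monoid)"
  proof (rule subgroupI)
    show "scalars3 \<subseteq> carrier (GL3 :: ('k ^ 3 ^ 3) monoid)" using carrier by (auto simp: scalars3_def)
    show "scalars3 \<noteq> ({} :: ('k ^ 3 ^ 3) set)" by (auto simp: scalars3_def intro!: exI[of _ 1])
  next
    fix A :: "'k ^ 3 ^ 3" assume "A \<in> scalars3"
    then obtain c where "c \<noteq> 0" "A = mat c" by (auto simp: scalars3_def)
    then show "inv\<^bsub>GL3\<^esub> A \<in> scalars3"
      using inv_eq[of c] by (auto simp: scalars3_def intro!: exI[of _ "inverse c"])
  next
    fix A B :: "'k ^ 3 ^ 3" assume "A \<in> scalars3" "B \<in> scalars3"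
    then obtain c d where "c \<noteq> 0" "A = mat c" "d \<noteq> 0" "B = mat d" by (auto simp: scalars3_def)
    then show "A \<otimes>\<^bsub>GL3\<^esub> B \<in> scalars3"
      by (auto simp: scalars3_def GL3_def mat_mult_mat intro!: exI[of _ "c * d"])
  qed
  moreover have "\<forall>A\<in>carrier GL3. scalars3 #>\<^bsub>GL3\<^esub> A = A <#\<^bsub>GL3\<^esub> (scalars3 :: ('k ^ 3 ^ 3) set)"
    by (auto simp: r_coset_def l_coset_def scalars3_def GL3_def mat_mult_left mat_mult_right)
  ultimately show ?thesis
    by (simp add: normal_def normal_axioms_def group_GL3)
qed

lemma group_PGL3: "group (PGL3 :: ('k::field ^ 3 ^ 3) set monoid)"
  unfolding PGL3_def using normal_scalars3 by (rule normal.factorgroup_is_group)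

lemma pgl_act_coset:
  assumes "vec.subspace V"
  shows "pgl_act (scalars3 #>\<^bsub>GL3\<^esub> A) V = (\<lambda>v. A *v v) ` V"
proof -
  have *: "(mat c ** A) *v v = A *v (c *s v)" for c :: 'a and v :: "'a ^ 3"
    by (simp add: matrix_vector_mul_assoc[symmetric] mat_vector_mult vec.scale)
  show ?thesis
  proof
    show "pgl_act (scalars3 #>\<^bsub>GL3\<^esub> A) V \<subseteq> (\<lambda>v. A *v v) ` V"
      using vec.subspace_scale[OF assms]
      by (auto simp: pgl_act_def r_coset_def scalars3_def GL3_def *)
    have "mat 1 \<in> (scalars3 :: ('a ^ 3 ^ 3) set)"
      unfolding scalars3_def using one_neq_zero by blast
    then have "A \<in> scalars3 #>\<^bsub>GL3\<^esub> A"
      unfolding r_coset_def GL3_def by (auto intro: bexI[of _ "mat 1"])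
    then have "A *v v \<in> pgl_act (scalars3 #>\<^bsub>GL3\<^esub> A) V" if "v \<in> V" for v
      using that by (auto simp: pgl_act_def)
    then show "(\<lambda>v. A *v v) ` V \<subseteq> pgl_act (scalars3 #>\<^bsub>GL3\<^esub> A) V" by blast
  qed
qed

section \<open>The blown-up space\<close>

definition planes_through :: "('k::field ^ 3) set \<Rightarrow> ('k ^ 3) set set" where
  "planes_through z = {l \<in> planes. z \<subseteq> l}"

definition blowup :: "('k::field ^ 3) set \<Rightarrow> (('k ^ 3) set \<times> ('k ^ 3) set) set" where
  "blowup z = {(w, l) \<in> proj_plane \<times> planes_through z. w \<subseteq> l}"

definition blowup_topology ::
    "('k::{field, topological_space} ^ 3) set \<Rightarrow> (('k ^ 3) set \<times> ('k ^ 3) set) topology" where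
  "blowup_topology z =
     subtopology (prod_topology proj_topology (subtopology plane_topology (planes_through z)))
       (blowup z)"

definition orbit :: "('k::field ^ 3 ^ 3) set set \<Rightarrow> ('k ^ 3) set \<Rightarrow> ('k ^ 3) set set" where
  "orbit \<Gamma> z0 = (\<lambda>\<gamma>. pgl_act \<gamma> z0) ` \<Gamma>"

text \<open>The points of the blown-up space are families indexed by the orbit \<open>Z\<close> of \<open>z0\<close>; as usual
  for \<^const>\<open>PiE\<close>, they are functions that are \<^const>\<open>undefined\<close> outside \<open>Z\<close>.\<close>

definition hat_space ::
    "('k::field ^ 3 ^ 3) set set \<Rightarrow> ('k ^ 3) set
     \<Rightarrow> (('k ^ 3) set \<Rightarrow> ('k ^ 3) set \<times> ('k ^ 3) set) set" where
  "hat_space \<Gamma> z0 =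
     {x \<in> (\<Pi>\<^sub>E z\<in>orbit \<Gamma> z0. blowup z). \<forall>y\<in>orbit \<Gamma> z0. \<forall>z\<in>orbit \<Gamma> z0. fst (x z) = fst (x y)}"

definition hat_topology ::
    "('k::{field, topological_space} ^ 3 ^ 3) set set \<Rightarrow> ('k ^ 3) set
     \<Rightarrow> (('k ^ 3) set \<Rightarrow> ('k ^ 3) set \<times> ('k ^ 3) set) topology" where
  "hat_topology \<Gamma> z0 =
     subtopology (product_topology blowup_topology (orbit \<Gamma> z0)) (hat_space \<Gamma> z0)"

text \<open>The common value of the \<open>fst (x z)\<close> is read off at the index \<open>z = z0\<close>.\<close>

definition hat_proj ::
    "('k::field ^ 3) set \<Rightarrow> (('k ^ 3) set \<Rightarrow> ('k ^ 3) set \<times> ('k ^ 3) set) \<Rightarrow> ('k ^ 3) set" where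
  "hat_proj z0 x = fst (x z0)"

text \<open>\<open>hat_act \<Gamma> z0 \<gamma> x\<close> has the component \<open>\<gamma> (x z)\<close> at the index \<open>\<gamma> z\<close>; see \<open>hat_act_apply\<close>.\<close>

definition hat_act ::
    "('k::field ^ 3 ^ 3) set set \<Rightarrow> ('k ^ 3) set \<Rightarrow> ('k ^ 3 ^ 3) set
     \<Rightarrow> (('k ^ 3) set \<Rightarrow> ('k ^ 3) set \<times> ('k ^ 3) set)
     \<Rightarrow> (('k ^ 3) set \<Rightarrow> ('k ^ 3) set \<times> ('k ^ 3) set)" where
  "hat_act \<Gamma> z0 \<gamma> x =
     (\<lambda>y\<in>orbit \<Gamma> z0. map_prod (pgl_act \<gamma>) (pgl_act \<gamma>) (x (pgl_act (inv\<^bsub>PGL3\<^esub> \<gamma>) y)))"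

lemma topspace_blowup_topology [simp]: "topspace (blowup_topology z) = blowup z"
  by (auto simp: blowup_topology_def blowup_def planes_through_def)

lemma topspace_hat_topology [simp]: "topspace (hat_topology \<Gamma> z0) = hat_space \<Gamma> z0"
  by (auto simp: hat_topology_def hat_space_def)

lemma pgl_act_pgl_act: "pgl_act g (pgl_act h V) = pgl_act (g \<otimes>\<^bsub>PGL3\<^esub> h) V"
  unfolding pgl_act_def PGL3_def FactGroup_def set_mult_def GL3_def
  by (auto simp: matrix_vector_mul_assoc) (metis matrix_vector_mul_assoc)+

lemma pgl_act_one: "vec.subspace V \<Longrightarrow> pgl_act \<one>\<^bsub>PGL3\<^esub> V = V"
proof -
  assume V: "vec.subspace V"
  interpret group "GL3 :: ('a ^ 3 ^ 3) monoid" by (rule group_GL3)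
  interpret normal scalars3 "GL3 :: ('a ^ 3 ^ 3) monoid" by (rule normal_scalars3)
  have "(\<one>\<^bsub>PGL3\<^esub> :: ('a ^ 3 ^ 3) set) = scalars3 #>\<^bsub>GL3\<^esub> \<one>\<^bsub>GL3\<^esub>"
    unfolding PGL3_def FactGroup_def using coset_mult_one[OF subset] by simp
  then show ?thesis using pgl_act_coset[OF V, of "\<one>\<^bsub>GL3\<^esub>"] by (simp add: GL3_def)
qed

lemma hat_act_apply:
  assumes "subgroup \<Gamma> PGL3" "z0 \<in> proj_plane" "\<gamma> \<in> \<Gamma>" "z \<in> orbit \<Gamma> z0"
  shows "hat_act \<Gamma> z0 \<gamma> x (pgl_act \<gamma> z) = map_prod (pgl_act \<gamma>) (pgl_act \<gamma>) (x z)"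
proof -
  interpret group "PGL3 :: ('a ^ 3 ^ 3) set monoid" by (rule group_PGL3)
  interpret subgroup \<Gamma> PGL3 by (rule assms)
  obtain \<delta> where \<delta>: "\<delta> \<in> \<Gamma>" "z = pgl_act \<delta> z0" using assms(4) by (auto simp: orbit_def)
  have c: "\<gamma> \<in> carrier PGL3" "\<delta> \<in> carrier PGL3" using assms(3) \<delta>(1) by auto
  have "pgl_act \<gamma> z = pgl_act (\<gamma> \<otimes>\<^bsub>PGL3\<^esub> \<delta>) z0" by (simp add: \<delta>(2) pgl_act_pgl_act)
  then have "pgl_act \<gamma> z \<in> orbit \<Gamma> z0" using assms(3) \<delta>(1) by (auto simp: orbit_def)
  moreover have "pgl_act (inv\<^bsub>PGL3\<^esub> \<gamma>) (pgl_act \<gamma> z) = z"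
    using c by (simp add: \<delta>(2) pgl_act_pgl_act flip: m_assoc)
  ultimately show ?thesis by (simp add: hat_act_def)
qed

section \<open>The perturbed action and conjugacy\<close>

definition perturbed_act ::
    "('k::field ^ 3 ^ 3) set set \<Rightarrow> ('k ^ 3) set
     \<Rightarrow> ((('k ^ 3) set \<Rightarrow> ('k ^ 3) set \<times> ('k ^ 3) set) \<Rightarrow> ('k ^ 3) set)
     \<Rightarrow> ('k ^ 3 ^ 3) set \<Rightarrow> ('k ^ 3) set \<Rightarrow> ('k ^ 3) set" where
  "perturbed_act \<Gamma> z0 h \<gamma> = h \<circ> hat_act \<Gamma> z0 \<gamma> \<circ> inv_into (hat_space \<Gamma> z0) h"

definition conjugate_actions ::
    "'a topology \<Rightarrow> 'g set \<Rightarrow> ('g \<Rightarrow> 'a \<Rightarrow> 'a) \<Rightarrow> ('g \<Rightarrow> 'a \<Rightarrow> 'a) \<Rightarrow> bool" where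
  "conjugate_actions X \<Gamma> \<rho> \<sigma> \<longleftrightarrow>
     (\<exists>f. homeomorphic_map X X f \<and> (\<forall>\<gamma>\<in>\<Gamma>. \<forall>w\<in>topspace X. f (\<sigma> \<gamma> w) = \<rho> \<gamma> (f w)))"

end

theory Submission
  imports Defs "HOL-Algebra.Left_Coset"
begin

text \<open>A conjugacy composed with \<open>h\<close> is a \<open>\<Gamma>\<close>-equivariant homeomorphism \<open>F\<close> from the
  blown-up space to the projective plane \<open>M\<close>, so \<open>G = hat_proj z0 \<circ> F\<^sup>-\<^sup>1\<close> is a
  continuous equivariant map from \<open>M\<close> onto itself; it is not injective, because the fibre of
  \<open>hat_proj z0\<close> over \<open>z0\<close> contains a point for each plane through \<open>z0\<close>. But cocompactness of
  \<open>\<Gamma>\<close> alone forces such a map to be the identity. Given \<open>y\<close>, take \<open>g\<^sub>n\<close> in \<open>PGL3\<close> contracting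
  the complement of a line \<open>H\<close> to \<open>y\<close> and write \<open>g\<^sub>n k\<^sub>n \<in> \<Gamma>\<close> with \<open>k\<^sub>n\<close> clustering at
  some \<open>c\<close>. As \<open>G\<close> is onto and \<open>c\<^sup>-\<^sup>1 H\<close> is closed and nowhere dense, some \<open>x\<close> has neither \<open>x\<close> nor
  \<open>G x\<close> in \<open>c\<^sup>-\<^sup>1 H\<close>. Then \<open>g\<^sub>n k\<^sub>n x\<close> and \<open>g\<^sub>n k\<^sub>n (G x) = G (g\<^sub>n k\<^sub>n x)\<close> both cluster at
  \<open>y\<close>, whence \<open>G y = y\<close>.\<close>

section \<open>The p-adic field as a non-discrete topological ring\<close>

lemma tendsto_padic_iff:
  "(f \<longlongrightarrow> (l :: 'p::prime_card padic)) F \<longleftrightarrow> ((\<lambda>x. padic_norm (f x - l)) \<longlongrightarrow> 0) F"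
  using tendsto_dist_iff[of f l F] by (simp add: dist_padic_def)

lemma padic_norm_triangle: "padic_norm (x + y) \<le> padic_norm x + padic_norm y"
  using padic_norm_add_le[of x y] padic_norm_nonneg[of x] padic_norm_nonneg[of y] by linarith

instance padic :: (prime_card) topological_group_add
proof
  fix a b :: "'a padic"
  show "((\<lambda>x. fst x + snd x) \<longlongrightarrow> a + b) (nhds a \<times>\<^sub>F nhds b)"
  proof -
    have "((\<lambda>x. padic_norm (fst x - a)) \<longlongrightarrow> 0) (nhds a \<times>\<^sub>F nhds b)"
      "((\<lambda>x. padic_norm (snd x - b)) \<longlongrightarrow> 0) (nhds a \<times>\<^sub>F nhds b)"
      by (simp_all add: filterlim_fst filterlim_snd flip: tendsto_padic_iff)
    from tendsto_add_zero[OF this] show ?thesis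
      unfolding tendsto_padic_iff
    proof (rule Lim_null_comparison[rotated], intro always_eventually allI)
      fix x :: "'a padic \<times> 'a padic"
      have "fst x + snd x - (a + b) = (fst x - a) + (snd x - b)" by simp
      then show "norm (padic_norm (fst x + snd x - (a + b)))
          \<le> padic_norm (fst x - a) + padic_norm (snd x - b)"
        using padic_norm_triangle[of "fst x - a" "snd x - b"] by (simp only:) simp
    qed
  qed
  show "(uminus \<longlongrightarrow> - a) (nhds a)"
  proof -
    have "((\<lambda>x. padic_norm (x - a)) \<longlongrightarrow> 0) (nhds a)"
      by (simp add: filterlim_ident flip: tendsto_padic_iff)
    moreover have "padic_norm (- x - - a) = padic_norm (x - a)" for x
      using padic_norm_minus[of "x - a"] by simp
    ultimately show ?thesis by (simp add: tendsto_padic_iff)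
  qed
qed

instance padic :: (prime_card) topological_comm_monoid_add ..

instance padic :: (prime_card) topological_semigroup_mult
proof
  fix a b :: "'a padic"
  let ?F = "nhds a \<times>\<^sub>F nhds b"
  have f: "((\<lambda>x. padic_norm (fst x - a)) \<longlongrightarrow> 0) ?F" and s: "((\<lambda>x. padic_norm (snd x - b)) \<longlongrightarrow> 0) ?F"
    by (simp_all add: filterlim_fst filterlim_snd flip: tendsto_padic_iff)
  have "((\<lambda>x. padic_norm (fst x - a) * padic_norm (snd x - b)
      + (padic_norm a * padic_norm (snd x - b) + padic_norm (fst x - a) * padic_norm b)) \<longlongrightarrow> 0) ?F"
    by (intro tendsto_add_zero tendsto_mult_zero tendsto_mult_right_zero tendsto_mult_left_zero f s)
  then show "((\<lambda>x. fst x * snd x) \<longlongrightarrow> a * b) ?F"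
    unfolding tendsto_padic_iff
  proof (rule Lim_null_comparison[rotated], intro always_eventually allI)
    fix x :: "'a padic \<times> 'a padic"
    have "fst x * snd x - a * b
        = (fst x - a) * (snd x - b) + (a * (snd x - b) + (fst x - a) * b)"
      by (simp add: algebra_simps)
    then show "norm (padic_norm (fst x * snd x - a * b))
        \<le> padic_norm (fst x - a) * padic_norm (snd x - b)
          + (padic_norm a * padic_norm (snd x - b) + padic_norm (fst x - a) * padic_norm b)"
      using padic_norm_triangle[of "(fst x - a) * (snd x - b)" "a * (snd x - b) + (fst x - a) * b"]
        padic_norm_triangle[of "a * (snd x - b)" "(fst x - a) * b"]
      by (simp add: padic_norm_mult)
  qed
qed

lemma padic_norm_prime_power:
  "padic_norm (of_nat CARD('p) ^ n :: 'p::prime_card padic) = inverse (real CARD('p)) ^ n"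
proof -
  have "multiplicity (int CARD('p)) (int CARD('p)) = 1"
    using prime_gt_1_nat[OF prime_card[where 'a='p]] by (intro multiplicity_self) auto
  then have "padic_abs CARD('p) (of_nat CARD('p)) = inverse (real CARD('p))"
    using padic_abs_divide[OF prime_card[where 'a='p], of "int CARD('p)" 1]
      prime_gt_0_nat[OF prime_card[where 'a='p]] by (simp add: power_int_minus)
  then have "padic_norm (of_nat CARD('p) :: 'p padic) = inverse (real CARD('p))"
    using padic_norm_of_rat[of "of_nat CARD('p)", where 'p='p] by simp
  moreover have "padic_norm (1 :: 'p padic) = 1"
    using padic_norm_of_rat[of 1, where 'p='p] by simp
  ultimately show ?thesis by (induction n) (simp_all add: padic_norm_mult)
qed

text \<open>The powers of p are nonzero and tend to 0, so no point is isolated. This later makes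
  \<open>at 0\<close> a proper filter, from which nonzero parameters close to 0 can be
  drawn.\<close>

instance padic :: (prime_card) perfect_space
proof
  fix x :: "'a padic"
  show "\<not> open {x}"
  proof
    assume "open {x}"
    then obtain e where e: "e > 0" "\<And>y. dist y x < e \<Longrightarrow> y = x"
      unfolding open_dist by auto
    have "inverse (real CARD('a)) < 1"
      using prime_gt_1_nat[OF prime_card[where 'a='a]] by (simp add: inverse_less_1_iff)
    then obtain n where n: "inverse (real CARD('a)) ^ n < e"
      using real_arch_pow_inv[OF e(1)] by blast
    have "x + of_nat CARD('a) ^ n = x"
      by (rule e(2)) (use n in \<open>simp add: dist_padic_def padic_norm_prime_power\<close>)
    then show False using prime_gt_0_nat[OF prime_card[where 'a='a]] by simp
  qed
qed

section \<open>Continuity of matrix products\<close>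

lemma tendsto_matrix_vector_mult:
  fixes A :: "'b \<Rightarrow> ('k::{field, topological_comm_monoid_add, topological_semigroup_mult}) ^ 'n ^ 'm"
  assumes "(A \<longlongrightarrow> A0) F" "(v \<longlongrightarrow> v0) F"
  shows "((\<lambda>x. A x *v v x) \<longlongrightarrow> A0 *v v0) F"
  unfolding matrix_vector_mult_def
  by (intro tendsto_vec_lambda tendsto_sum tendsto_mult tendsto_vec_nth assms)

lemma tendsto_matrix_mult:
  fixes A :: "'b \<Rightarrow> ('k::{field, topological_comm_monoid_add, topological_semigroup_mult}) ^ 'n ^ 'm"
  assumes "(A \<longlongrightarrow> A0) F" "(B \<longlongrightarrow> B0) F"
  shows "((\<lambda>x. A x ** B x) \<longlongrightarrow> A0 ** B0) F"
  unfolding matrix_matrix_mult_def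
  by (intro tendsto_vec_lambda tendsto_sum tendsto_mult tendsto_vec_nth assms)

section \<open>The topology of the projective plane, and contracting matrices\<close>

lemma proj_plane_span: "v \<noteq> 0 \<Longrightarrow> vec.span {v} \<in> (proj_plane :: ('k::field ^ 3) set set)"
  by (auto simp: proj_plane_def vec.dim_span vec.dim_eq_card_independent)

lemma proj_plane_cases:
  assumes "w \<in> (proj_plane :: ('k::{field, topological_space} ^ 3) set set)"
  obtains v where "v \<noteq> 0" "w = vec.span {v}"
  using assms unfolding topspace_proj_topology[symmetric] proj_topology_def by auto

text \<open>The quotient topology gives openness only relative to the nonzero vectors. These form an
  open set because points are closed, so the preimage is open outright.\<close>

lemma open_span_preimage:
  fixes U :: "('k::{field, t1_space} ^ 3) set set"
  assumes "openin proj_topology U"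
  shows "open {v. v \<noteq> 0 \<and> vec.span {v} \<in> U}"
proof -
  have "{v :: 'k ^ 3. v \<noteq> 0} = (\<Union>i. (\<lambda>v. v $ i) -` (- {0}))" by (auto simp: vec_eq_iff)
  then have "open {v :: 'k ^ 3. v \<noteq> 0}" by (auto intro!: open_vimage_vec_nth)
  moreover have "openin (top_of_set {v. v \<noteq> 0}) {v. v \<noteq> 0 \<and> vec.span {v} \<in> U}"
    using assms by (simp add: proj_topology_def openin_quotient_topology)
  ultimately show ?thesis by (simp add: openin_open_eq)
qed

text \<open>Reduces convergence of points of the projective plane to convergence of representing
  vectors, provided that the limit vector is nonzero.\<close>

lemma eventually_span_in:
  fixes U :: "('k::{field, t1_space} ^ 3) set set"
  assumes "openin proj_topology U" "(f \<longlongrightarrow> v) F" "v \<noteq> 0" "vec.span {v} \<in> U"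
  shows "eventually (\<lambda>x. f x \<noteq> 0 \<and> vec.span {f x} \<in> U) F"
  using topological_tendstoD[OF assms(2) open_span_preimage[OF assms(1)]] assms(3,4) by simp

lemma openin_proj_topology_iff:
  fixes U :: "('k::{field, t1_space} ^ 3) set set"
  shows "openin proj_topology U \<longleftrightarrow> U \<subseteq> proj_plane \<and> open {v. v \<noteq> 0 \<and> vec.span {v} \<in> U}"
proof
  assume "openin proj_topology U"
  then show "U \<subseteq> proj_plane \<and> open {v. v \<noteq> 0 \<and> vec.span {v} \<in> U}"
    using openin_subset open_span_preimage by fastforce
next
  assume *: "U \<subseteq> proj_plane \<and> open {v. v \<noteq> 0 \<and> vec.span {v} \<in> U}"
  then have "openin (top_of_set {v. v \<noteq> 0}) {v. v \<noteq> 0 \<and> vec.span {v} \<in> U}"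
    unfolding openin_open by (intro exI[of _ "{v. v \<noteq> 0 \<and> vec.span {v} \<in> U}"]) auto
  moreover have "U \<subseteq> (\<lambda>v. vec.span {v}) ` topspace (top_of_set {v. v \<noteq> 0})"
    using * by (auto elim!: proj_plane_cases)
  ultimately show "openin proj_topology U"
    by (simp add: proj_topology_def openin_quotient_topology)
qed

lemma nonvanishing_on_span:
  "(\<exists>v\<in>vec.span {u}. (A *v v) $ i \<noteq> 0) \<longleftrightarrow> (A *v u) $ i \<noteq> (0 :: 'k::field)"
  by (auto simp: vec.span_singleton vec.scale intro!: exI[of _ 1])

text \<open>With H the kernel of the \<open>i\<close>-th coordinate, this is the set of points
  outside the preimage of H under \<open>A\<close>. Asking for some \<open>v\<close> in
  \<open>w\<close> frees the condition from the choice of a representative.\<close>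

lemma openin_nonvanishing:
  fixes A :: "'k::{field, t1_space, topological_comm_monoid_add, topological_semigroup_mult} ^ 3 ^ 3"
  shows "openin proj_topology {w \<in> proj_plane. \<exists>v\<in>w. (A *v v) $ i \<noteq> 0}"
proof -
  have "continuous_on UNIV (\<lambda>v. (A *v v) $ i)"
    unfolding continuous_on_def
    by (intro ballI tendsto_vec_nth tendsto_matrix_vector_mult tendsto_const tendsto_ident_at)
  then have "open ((\<lambda>v. (A *v v) $ i) -` (- {0}))"
    by (intro open_vimage) auto
  moreover have "{v. v \<noteq> 0 \<and> vec.span {v} \<in> {w \<in> proj_plane. \<exists>v\<in>w. (A *v v) $ i \<noteq> 0}}
      = (\<lambda>v. (A *v v) $ i) -` (- {0})"
  proof -
    have "v \<noteq> 0" if "(A *v v) $ i \<noteq> 0" for v using that by auto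
    then show ?thesis by (auto simp: nonvanishing_on_span proj_plane_span)
  qed
  ultimately show ?thesis by (auto simp: openin_proj_topology_iff)
qed

text \<open>A homothety on the kernel of the \<open>i\<close>-th coordinate that fixes \<open>y\<close> when \<open>y $ i = 1\<close>;
  as \<open>t\<close> tends to \<open>0\<close> it contracts the complement of that kernel to the point spanned by \<open>y\<close>.\<close>

definition contraction :: "'k::field ^ 'n \<Rightarrow> 'n \<Rightarrow> 'k \<Rightarrow> 'k ^ 'n ^ 'n" where
  "contraction y i t =
     (\<chi> r s. t * (if r = s then 1 else 0) + (1 - t) * (if s = i then y $ r else 0))"

lemma contraction_mult: "contraction y i t *v v = t *s v + ((1 - t) * v $ i) *s y"
proof -
  have "(\<Sum>s\<in>UNIV. (t * (if r = s then 1 else 0) + (1 - t) * (if s = i then y $ r else 0)) * v $ s)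
      = (\<Sum>s\<in>UNIV. if r = s then t * v $ s else 0)
        + (\<Sum>s\<in>UNIV. if s = i then (1 - t) * y $ r * v $ s else 0)" for r
    unfolding sum.distrib[symmetric] by (rule sum.cong) (auto simp: distrib_right)
  then show ?thesis
    by (simp add: vec_eq_iff matrix_vector_mult_def contraction_def algebra_simps)
qed

lemma invertible_contraction:
  assumes "y $ i = 1" "t \<noteq> 0"
  shows "invertible (contraction y i t)"
proof -
  have "v = 0" if "contraction y i t *v v = 0" for v
  proof -
    have eq: "t *s v + ((1 - t) * v $ i) *s y = 0" using that by (simp add: contraction_mult)
    \<comment> \<open>Since \<open>y $ i = 1\<close>, the contraction preserves the
      \<open>i\<close>-th coordinate; so \<open>v $ i\<close> vanishes, and what remains of the
      equation is \<open>t *s v = 0\<close>.\<close>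
    then have "(t *s v + ((1 - t) * v $ i) *s y) $ i = 0" by simp
    then have "v $ i = 0" using assms(1) by (simp add: algebra_simps)
    then show ?thesis using eq assms(2) by simp
  qed
  then have "\<exists>B. B ** contraction y i t = mat 1"
    by (simp add: matrix_left_invertible_ker)
  then show ?thesis by (simp add: invertible_left_inverse)
qed

lemma tendsto_contraction:
  fixes f :: "'b \<Rightarrow> 'k::{field, topological_group_add, topological_comm_monoid_add, topological_semigroup_mult}"
  assumes "(f \<longlongrightarrow> t) F"
  shows "((\<lambda>x. contraction y i (f x)) \<longlongrightarrow> contraction y i t) F"
  unfolding contraction_def
  by (intro tendsto_vec_lambda tendsto_add tendsto_mult tendsto_const tendsto_diff assms)

section \<open>Matrix representatives for PGL3, and cocompactness\<close>

abbreviation pgl_coset :: "'k::field ^ 3 ^ 3 \<Rightarrow> ('k ^ 3 ^ 3) set" where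
  "pgl_coset A \<equiv> scalars3 #>\<^bsub>GL3\<^esub> A"

lemma pgl_coset_carrier: "invertible A \<Longrightarrow> pgl_coset A \<in> carrier PGL3"
  by (auto simp: PGL3_def carrier_FactGroup GL3_def)

lemma carrier_PGL3_cases:
  assumes "g \<in> carrier PGL3"
  obtains A where "invertible A" "g = pgl_coset A"
  using assms by (auto simp: PGL3_def carrier_FactGroup GL3_def)

lemma pgl_coset_mult:
  assumes "invertible A" "invertible B"
  shows "pgl_coset A \<otimes>\<^bsub>PGL3\<^esub> pgl_coset B = pgl_coset (A ** B)"
  using normal.rcos_sum[OF normal_scalars3, of A B] assms
  by (simp add: PGL3_def GL3_def)

lemma pgl_act_span: "pgl_act (pgl_coset A) (vec.span {v}) = vec.span {A *v v}"
proof -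
  have "pgl_act (pgl_coset A) (vec.span {v}) = (*v) A ` vec.span {v}"
    by (rule pgl_act_coset) (rule vec.subspace_span)
  then show ?thesis by (simp add: vec.span_singleton image_image vec.scale)
qed

lemma invertible_mult_nonzero: "invertible A \<Longrightarrow> v \<noteq> 0 \<Longrightarrow> A *v v \<noteq> 0"
  by (metis invertible_def matrix_vector_mul_assoc matrix_vector_mul_lid matrix_vector_mult_0_right)

lemma pgl_act_proj_plane:
  fixes w :: "('k::{field, topological_space} ^ 3) set"
  assumes "g \<in> carrier PGL3" "w \<in> proj_plane"
  shows "pgl_act g w \<in> proj_plane"
proof -
  obtain A where "invertible A" "g = pgl_coset A" using assms(1) by (rule carrier_PGL3_cases)
  moreover obtain v where "v \<noteq> 0" "w = vec.span {v}" using assms(2) by (rule proj_plane_cases)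
  ultimately show ?thesis by (simp add: pgl_act_span invertible_mult_nonzero proj_plane_span)
qed

lemma openin_PGL3_topology:
  "openin PGL3_topology U \<longleftrightarrow> U \<subseteq> carrier PGL3
     \<and> openin (top_of_set {A. invertible A}) {A. invertible A \<and> pgl_coset A \<in> U}"
  unfolding PGL3_topology_def openin_quotient_topology
  by (simp add: PGL3_def carrier_FactGroup) (simp add: GL3_def)

text \<open>The images of the sets \<open>N c\<close> in the quotient by \<open>\<Gamma>\<close> are
  open and cover it, so finitely many suffice by compactness. This replaces the clustering of the
  k_n at some c: the product \<open>B ** D\<close> plays the role of k_n, and its neighbourhood
  comes from a finite list.\<close>

lemma cocompact_finite_cover:
  fixes \<Gamma> :: "('k::{field, topological_comm_monoid_add, topological_semigroup_mult} ^ 3 ^ 3) set set"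
    and N :: "'k ^ 3 ^ 3 \<Rightarrow> ('k ^ 3 ^ 3) set"
  assumes \<Gamma>: "subgroup \<Gamma> PGL3"
    and compact: "compact_space (quotient_topology PGL3_topology (\<lambda>g. g <#\<^bsub>PGL3\<^esub> \<Gamma>))"
    and N: "\<And>c. invertible c \<Longrightarrow> open (N c) \<and> c \<in> N c"
  obtains C where "finite C" "C \<subseteq> {c. invertible c}"
    "\<And>B. invertible B \<Longrightarrow> \<exists>c\<in>C. \<exists>D. invertible D \<and> pgl_coset D \<in> \<Gamma> \<and> B ** D \<in> N c"
proof -
  interpret PGL: group "PGL3 :: ('k ^ 3 ^ 3) set monoid" by (rule group_PGL3)
  interpret subgroup \<Gamma> PGL3 by (rule \<Gamma>)
  let ?Q = "quotient_topology PGL3_topology (\<lambda>g. g <#\<^bsub>PGL3\<^esub> \<Gamma>)"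
  let ?q = "\<lambda>A. pgl_coset A <#\<^bsub>PGL3\<^esub> \<Gamma>"
  define S where "S c = ?q ` {A \<in> N c. invertible A}" for c
  \<comment> \<open>Equality of cosets of \<open>\<Gamma>\<close> is expressed by matrices. Letting
    \<open>D\<close> run over all representatives of elements of \<open>\<Gamma>\<close> absorbs the
    scalars, so that \<open>A = B ** D\<close> holds exactly; the witness is the inverse of
    \<open>B\<close> times \<open>A\<close>.\<close>
  have q_eq: "?q B = ?q A \<longleftrightarrow> (\<exists>D. invertible D \<and> pgl_coset D \<in> \<Gamma> \<and> A = B ** D)"
    if AB: "invertible A" "invertible B" for A B :: "'k ^ 3 ^ 3"
  proof
    assume "?q B = ?q A"
    then have "pgl_coset A \<in> ?q B"
      using PGL.lcos_self[OF pgl_coset_carrier[OF AB(1)] \<Gamma>] by simp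
    then obtain g where g: "g \<in> \<Gamma>" "pgl_coset A = pgl_coset B \<otimes>\<^bsub>PGL3\<^esub> g"
      by (auto simp: l_coset_def)
    obtain B' where B': "B ** B' = mat 1" "B' ** B = mat 1"
      using AB(2) by (auto simp: invertible_def)
    then have inv: "invertible (B' ** A)"
      by (intro invertible_mult AB) (auto simp: invertible_def)
    have BB'A: "B ** (B' ** A) = A" by (simp add: matrix_mul_assoc B')
    then have "pgl_coset B \<otimes>\<^bsub>PGL3\<^esub> pgl_coset (B' ** A) = pgl_coset B \<otimes>\<^bsub>PGL3\<^esub> g"
      using g(2) by (simp add: pgl_coset_mult AB inv)
    then have "pgl_coset (B' ** A) = g"
      using g(1) by (simp add: pgl_coset_carrier AB inv mem_carrier)
    then show "\<exists>D. invertible D \<and> pgl_coset D \<in> \<Gamma> \<and> A = B ** D"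
      using g(1) inv BB'A by metis
  next
    assume "\<exists>D. invertible D \<and> pgl_coset D \<in> \<Gamma> \<and> A = B ** D"
    then have "pgl_coset A \<in> ?q B"
      using AB by (auto simp: l_coset_def pgl_coset_mult[symmetric])
    then show "?q B = ?q A"
      using PGL.l_repr_independence[OF _ pgl_coset_carrier[OF AB(2)] \<Gamma>] by blast
  qed
  have S_iff: "?q B \<in> S c \<longleftrightarrow> (\<exists>D. invertible D \<and> pgl_coset D \<in> \<Gamma> \<and> B ** D \<in> N c)"
    if B: "invertible B" for B c
  proof -
    have "?q B \<in> S c \<longleftrightarrow> (\<exists>A. A \<in> N c \<and> invertible A \<and> ?q B = ?q A)"
      unfolding S_def by blast
    also have "\<dots> \<longleftrightarrow> (\<exists>A. A \<in> N c \<and> invertible A \<and>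
        (\<exists>D. invertible D \<and> pgl_coset D \<in> \<Gamma> \<and> A = B ** D))"
      using q_eq[OF _ B] by metis
    also have "\<dots> \<longleftrightarrow> (\<exists>D. invertible D \<and> pgl_coset D \<in> \<Gamma> \<and> B ** D \<in> N c)"
      using invertible_mult[OF B] by blast
    finally show ?thesis .
  qed
  have opens: "openin ?Q (S c)" if c: "invertible c" for c
  proof -
    have "open ((\<lambda>A. A ** D) -` N c)" for D :: "'k ^ 3 ^ 3"
    proof (rule open_vimage)
      show "open (N c)" using N[OF c] by blast
      show "continuous_on UNIV (\<lambda>A. A ** D)"
        unfolding continuous_on_def by (intro ballI tendsto_matrix_mult tendsto_const tendsto_ident_at)
    qed
    \<comment> \<open>The saturation of \<open>N c\<close> under \<open>\<Gamma>\<close> is a union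
      of preimages of \<open>N c\<close> under right multiplications, hence relatively open.\<close>
    moreover have "{A. invertible A \<and> ?q A \<in> S c}
        = {A. invertible A} \<inter> (\<Union>D\<in>{D. invertible D \<and> pgl_coset D \<in> \<Gamma>}. (\<lambda>A. A ** D) -` N c)"
      using S_iff by blast
    ultimately have "openin (top_of_set {A. invertible A}) {A. invertible A \<and> ?q A \<in> S c}"
      by auto
    then have "openin PGL3_topology {g \<in> carrier PGL3. g <#\<^bsub>PGL3\<^esub> \<Gamma> \<in> S c}"
      by (auto simp: openin_PGL3_topology pgl_coset_carrier cong: conj_cong)
    moreover have "S c \<subseteq> (\<lambda>g. g <#\<^bsub>PGL3\<^esub> \<Gamma>) ` carrier PGL3"
      by (auto simp: S_def pgl_coset_carrier)
    ultimately show ?thesis by (simp add: openin_quotient_topology)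
  qed
  have cover: "topspace ?Q \<subseteq> \<Union> (S ` {c. invertible c})"
    using N by (fastforce simp: S_def elim!: carrier_PGL3_cases)
  obtain \<F> where "finite \<F>" "\<F> \<subseteq> S ` {c. invertible c}" "topspace ?Q \<subseteq> \<Union>\<F>"
    using compact opens cover unfolding compact_space_alt
    by (metis (no_types, lifting) imageE mem_Collect_eq)
  then obtain C where C: "C \<subseteq> {c. invertible c}" "finite C" "topspace ?Q \<subseteq> \<Union> (S ` C)"
    by (metis finite_subset_image)
  have "\<exists>c\<in>C. \<exists>D. invertible D \<and> pgl_coset D \<in> \<Gamma> \<and> B ** D \<in> N c" if B: "invertible B" for B
  proof -
    have "?q B \<in> topspace ?Q" using pgl_coset_carrier[OF B] by simp
    then show ?thesis using C(3) S_iff[OF B] by blast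
  qed
  then show thesis using that C(1,2) by blast
qed

section \<open>Rigidity of equivariant maps of the projective plane\<close>

text \<open>The contraction argument is carried out with neighbourhoods instead of sequences. If
  \<open>G y\<close> differs from \<open>y\<close>, some neighbourhood \<open>W\<close> of
  \<open>y\<close> is disjoint from its image under \<open>G\<close>; the dynamics then produce a
  point of \<open>W\<close> whose image lies in \<open>W\<close> as well.\<close>

lemma cocompact_equivariant_eq_id:
  fixes \<Gamma> :: "('k::{field, t1_space, perfect_space, topological_group_add, topological_comm_monoid_add,
      topological_semigroup_mult} ^ 3 ^ 3) set set"
  assumes \<Gamma>: "subgroup \<Gamma> PGL3"
    and compact: "compact_space (quotient_topology PGL3_topology (\<lambda>g. g <#\<^bsub>PGL3\<^esub> \<Gamma>))"
    and Hausdorff: "Hausdorff_space (proj_topology :: ('k ^ 3) set topology)"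
    and cont: "continuous_map proj_topology proj_topology G"
    and surj: "G ` proj_plane = proj_plane"
    and equi: "\<And>\<gamma> w. \<gamma> \<in> \<Gamma> \<Longrightarrow> w \<in> proj_plane \<Longrightarrow> G (pgl_act \<gamma> w) = pgl_act \<gamma> (G w)"
    and y: "y \<in> proj_plane"
  shows "G y = y"
proof (rule ccontr)
  assume neq: "G y \<noteq> y"
  have G: "G w \<in> proj_plane" if "w \<in> proj_plane" for w using surj that by blast
  obtain U V where UV: "openin proj_topology U" "openin proj_topology V" "y \<in> U" "G y \<in> V" "disjnt U V"
    using Hausdorff neq y G[OF y] unfolding Hausdorff_space_def topspace_proj_topology by metis
  define W where "W = U \<inter> {w \<in> proj_plane. G w \<in> V}"
  have W: "openin proj_topology W" "y \<in> W"
    using UV y openin_continuous_map_preimage[OF cont UV(2)] by (auto simp: W_def)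
  have W': "G w \<notin> W" if "w \<in> W" for w
    using that UV(5) by (auto simp: W_def disjnt_def)
  obtain y1 where y1: "y1 \<noteq> 0" "y = vec.span {y1}" using y by (rule proj_plane_cases)
  then obtain i where i: "y1 $ i \<noteq> 0" by (auto simp: vec_eq_iff)
  \<comment> \<open>The representative of \<open>y\<close> is normalised to have \<open>i\<close>-th
    coordinate 1, which makes the contractions invertible for nonzero parameters.\<close>
  define y0 where "y0 = inverse (y1 $ i) *s y1"
  have y0: "y0 $ i = 1" using i by (simp add: y0_def)
  have span_y0: "vec.span {k *s y0} = y" if "k \<noteq> 0" for k
  proof -
    have "vec.span {k *s y0} = vec.span ((\<lambda>x. (k * inverse (y1 $ i)) *s x) ` {y1})"
      by (simp add: y0_def)
    also have "\<dots> = y" unfolding y1(2) using that i by (intro vec.span_image_scale) auto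
    finally show ?thesis .
  qed
  let ?A = "contraction y0 i"
  \<comment> \<open>Let H be the kernel of the \<open>i\<close>-th coordinate. Some point avoids the
    preimage of H under \<open>c\<close> together with its image under \<open>G\<close>: start from
    a point whose image is good, then perturb it.\<close>
  have generic: "\<exists>a b. a \<noteq> 0 \<and> b \<noteq> 0 \<and> (c *v a) $ i \<noteq> 0 \<and> (c *v b) $ i \<noteq> 0 \<and> G (vec.span {a}) = vec.span {b}"
    if c: "invertible c" for c
  proof -
    let ?N = "{w \<in> proj_plane. \<exists>v\<in>w. (c *v v) $ i \<noteq> 0}"
    have N: "vec.span {v} \<in> ?N \<longleftrightarrow> v \<noteq> 0 \<and> (c *v v) $ i \<noteq> 0" for v
    proof (cases "v = 0")
      case True
      then show ?thesis by (simp add: proj_plane_def)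
    next
      case False
      then show ?thesis by (simp add: proj_plane_span nonvanishing_on_span)
    qed
    obtain c' where "c ** c' = mat 1" using c by (auto simp: invertible_def)
    then have "c *v (c' *v y0) = y0" by (simp add: matrix_vector_mul_assoc)
    then obtain u where u: "(c *v u) $ i \<noteq> 0" using y0 by (metis one_neq_zero)
    then have "u \<noteq> 0" by auto
    then have "vec.span {u} \<in> G ` proj_plane" using surj proj_plane_span by blast
    then obtain x where x: "x \<in> proj_plane" "G x = vec.span {u}" by auto
    obtain v where v: "v \<noteq> 0" "x = vec.span {v}" using x(1) by (rule proj_plane_cases)
    have P: "openin proj_topology {w \<in> proj_plane. G w \<in> ?N}"
      using openin_continuous_map_preimage[OF cont openin_nonvanishing] by simp
    have lim: "((\<lambda>t. v + t *s u) \<longlongrightarrow> v) (at 0)"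
    proof -
      have "((\<lambda>t. \<chi> j. v $ j + t * u $ j) \<longlongrightarrow> (\<chi> j. v $ j + 0 * u $ j)) (at 0)"
        by (intro tendsto_vec_lambda tendsto_add tendsto_mult tendsto_const tendsto_ident_at)
      then show ?thesis by (simp add: plus_vec_def vector_scalar_mult_def)
    qed
    have Gx: "G x \<in> ?N" unfolding x(2) N using u \<open>u \<noteq> 0\<close> by blast
    then have "eventually (\<lambda>t. v + t *s u \<noteq> 0
        \<and> vec.span {v + t *s u} \<in> {w \<in> proj_plane. G w \<in> ?N}) (at 0)"
      using x(1) v(2) by (intro eventually_span_in[OF P lim v(1)]) blast
    then have ev: "eventually (\<lambda>t. v + t *s u \<noteq> 0 \<and> G (vec.span {v + t *s u}) \<in> ?N) (at 0)"
      by (rule eventually_mono) blast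
    \<comment> \<open>If \<open>v\<close> itself is bad, then \<open>v + t *s u\<close> is good for
      every nonzero \<open>t\<close>, as \<open>(c *v u) $ i\<close> is nonzero. For
      \<open>t\<close> near 0 the open condition on the image under \<open>G\<close>
      survives.\<close>
    obtain a where a: "a \<noteq> 0" "(c *v a) $ i \<noteq> 0" "G (vec.span {a}) \<in> ?N"
    proof (cases "(c *v v) $ i = 0")
      case True
      have "eventually (\<lambda>t :: 'k. t \<noteq> 0) (at 0)" by (simp add: eventually_at_filter)
      with ev have "eventually (\<lambda>t. t \<noteq> 0 \<and> v + t *s u \<noteq> 0 \<and> G (vec.span {v + t *s u}) \<in> ?N) (at 0)"
        by eventually_elim simp
      then obtain t where "t \<noteq> 0" "v + t *s u \<noteq> 0" "G (vec.span {v + t *s u}) \<in> ?N"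
        using eventually_happens'[OF at_neq_bot] by blast
      then show thesis
        using that[of "v + t *s u"] True u by (simp add: matrix_vector_right_distrib vec.scale)
    next
      case False
      then show thesis using that[OF v(1)] Gx v(2) by blast
    qed
    obtain b where b: "b \<noteq> 0" "G (vec.span {a}) = vec.span {b}"
      using G[OF proj_plane_span[OF a(1)]] by (rule proj_plane_cases)
    have "(c *v b) $ i \<noteq> 0" using a(3) unfolding b(2) N by blast
    then show ?thesis using a(1,2) b by blast
  qed
  \<comment> \<open>Packages the local data at \<open>c\<close>: a neighbourhood \<open>N\<close> of
    \<open>c\<close>, a condition \<open>P\<close> on the parameter valid near 0, and a pair
    \<open>a\<close>, \<open>b\<close> that all matrices \<open>?A t ** k\<close> so restricted send
    into \<open>W\<close>.\<close>
  define good where "good c N P a b \<longleftrightarrow> open N \<and> c \<in> N \<and> eventually P (nhds 0) \<and> a \<noteq> 0 \<and>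
      G (vec.span {a}) = vec.span {b} \<and>
      (\<forall>t k. P t \<longrightarrow> k \<in> N \<longrightarrow> vec.span {?A t *v (k *v a)} \<in> W \<and> vec.span {?A t *v (k *v b)} \<in> W)"
    for c N P a b
  have local: "\<exists>N P a b. good c N P a b" if c: "invertible c" for c
  proof -
    \<comment> \<open>At parameter 0 the contraction is singular but sends \<open>c *v v\<close> to
      a nonzero multiple of \<open>y0\<close>, hence into \<open>W\<close>. Joint continuity extends
      this to parameters near 0 and matrices near \<open>c\<close>.\<close>
    have contract: "eventually (\<lambda>x. vec.span {?A (fst x) *v (snd x *v v)} \<in> W) (nhds 0 \<times>\<^sub>F nhds c)"
      if v: "(c *v v) $ i \<noteq> 0" for v
    proof -
      have eq: "?A 0 *v (c *v v) = (c *v v) $ i *s y0" by (simp add: contraction_mult)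
      have "((\<lambda>x. ?A (fst x) *v (snd x *v v)) \<longlongrightarrow> ?A 0 *v (c *v v)) (nhds 0 \<times>\<^sub>F nhds c)"
        by (intro tendsto_matrix_vector_mult tendsto_contraction tendsto_const filterlim_fst filterlim_snd)
      moreover have "?A 0 *v (c *v v) \<noteq> 0" unfolding eq using y0 v by auto
      moreover have "vec.span {?A 0 *v (c *v v)} \<in> W" unfolding eq span_y0[OF v] by (rule W(2))
      ultimately have "eventually (\<lambda>x. ?A (fst x) *v (snd x *v v) \<noteq> 0
          \<and> vec.span {?A (fst x) *v (snd x *v v)} \<in> W) (nhds 0 \<times>\<^sub>F nhds c)"
        by (rule eventually_span_in[OF W(1)])
      then show ?thesis by (rule eventually_mono) blast
    qed
    obtain a b where ab: "a \<noteq> 0" "(c *v a) $ i \<noteq> 0" "(c *v b) $ i \<noteq> 0" "G (vec.span {a}) = vec.span {b}"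
      using generic[OF c] by blast
    have "eventually (\<lambda>x. vec.span {?A (fst x) *v (snd x *v a)} \<in> W
        \<and> vec.span {?A (fst x) *v (snd x *v b)} \<in> W) (nhds 0 \<times>\<^sub>F nhds c)"
      using contract[OF ab(2)] contract[OF ab(3)] by (rule eventually_conj)
    then obtain P Q where P: "eventually P (nhds 0)" and Q: "eventually Q (nhds c)"
      and PQ: "\<And>t k. P t \<Longrightarrow> Q k \<Longrightarrow>
        vec.span {?A t *v (k *v a)} \<in> W \<and> vec.span {?A t *v (k *v b)} \<in> W"
      unfolding eventually_prod_filter by auto
    obtain N where "open N" "c \<in> N" "\<forall>k\<in>N. Q k" using Q unfolding eventually_nhds by blast
    then have "good c N P a b" unfolding good_def using P PQ ab by blast
    then show ?thesis by blast
  qed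
  obtain N P a b where good: "\<And>c. invertible c \<Longrightarrow> good c (N c) (P c) (a c) (b c)"
    using local by metis
  have N: "\<And>c. invertible c \<Longrightarrow> open (N c) \<and> c \<in> N c"
    and P: "\<And>c. invertible c \<Longrightarrow> eventually (P c) (nhds 0)"
    and a: "\<And>c. invertible c \<Longrightarrow> a c \<noteq> 0"
    and b: "\<And>c. invertible c \<Longrightarrow> G (vec.span {a c}) = vec.span {b c}"
    and Wab: "\<And>c t k. invertible c \<Longrightarrow> P c t \<Longrightarrow> k \<in> N c \<Longrightarrow>
      vec.span {?A t *v (k *v a c)} \<in> W \<and> vec.span {?A t *v (k *v b c)} \<in> W"
    using good unfolding good_def by blast+
  obtain C where C: "finite C" "C \<subseteq> {c. invertible c}"
    "\<And>B. invertible B \<Longrightarrow> \<exists>c\<in>C. \<exists>D. invertible D \<and> pgl_coset D \<in> \<Gamma> \<and> B ** D \<in> N c"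
    using cocompact_finite_cover[OF \<Gamma> compact N] by blast
  \<comment> \<open>Finiteness of \<open>C\<close> allows one parameter to serve all its members; it
    can be taken nonzero because 0 is not isolated.\<close>
  have "eventually (\<lambda>t. \<forall>c\<in>C. P c t) (at 0)"
  proof (intro eventually_ball_finite C(1) ballI)
    fix c assume "c \<in> C"
    then have "eventually (P c) (nhds 0)" using C(2) P by blast
    then show "eventually (P c) (at 0)" unfolding eventually_at_filter by (rule eventually_mono) blast
  qed
  moreover have "eventually (\<lambda>t :: 'k. t \<noteq> 0) (at 0)" by (simp add: eventually_at_filter)
  ultimately have "eventually (\<lambda>t. t \<noteq> 0 \<and> (\<forall>c\<in>C. P c t)) (at 0)" by eventually_elim simp
  then obtain t where t: "t \<noteq> 0" "\<And>c. c \<in> C \<Longrightarrow> P c t"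
    using eventually_happens'[OF at_neq_bot] by blast
  have "invertible (?A t)" using y0 t(1) by (rule invertible_contraction)
  \<comment> \<open>The cover is applied to the inverse \<open>B\<close> of the contraction: with k
    = \<open>B ** D\<close> in \<open>N c\<close>, the contraction times k is \<open>D\<close>,
    which represents an element of \<open>\<Gamma>\<close>.\<close>
  then obtain B where B: "?A t ** B = mat 1" "B ** ?A t = mat 1" by (auto simp: invertible_def)
  then have "invertible B" by (auto simp: invertible_def)
  then obtain c D where cD: "c \<in> C" "pgl_coset D \<in> \<Gamma>" "B ** D \<in> N c" using C(3) by blast
  have D: "?A t *v ((B ** D) *v v) = D *v v" for v
    using B by (simp add: matrix_vector_mul_assoc matrix_mul_assoc)
  have c: "invertible c" using C cD by auto
  have "vec.span {D *v a c} \<in> W" "vec.span {D *v b c} \<in> W"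
    using Wab[OF c t(2) cD(3)] cD(1) by (simp_all add: D)
  \<comment> \<open>Equivariance carries the relation between \<open>a c\<close> and
    \<open>b c\<close> into \<open>W\<close>, contradicting the disjointness of \<open>W\<close>
    from its image.\<close>
  moreover have "G (vec.span {D *v a c}) = vec.span {D *v b c}"
    using equi[OF cD(2) proj_plane_span[OF a[OF c]]] by (simp add: b[OF c] pgl_act_span)
  ultimately show False using W' by metis
qed

section \<open>Planes through a point and fibres of the blowup\<close>

lemma pgl_act_planes:
  fixes l :: "('k::field ^ 3) set"
  assumes "g \<in> carrier PGL3" "l \<in> planes"
  shows "pgl_act g l \<in> planes"
proof -
  obtain A where A: "invertible A" "g = pgl_coset A" using assms(1) by (rule carrier_PGL3_cases)
  have l: "vec.subspace l" "vec.dim l = 2" using assms(2) by (auto simp: planes_def)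
  have "inj_on ((*v) A) (vec.span l)"
    using inj_matrix_vector_mult[OF A(1)] by (rule inj_on_subset) simp
  then have "vec.dim ((*v) A ` l) = 2"
    using l(2) vec.dim_image_eq[OF matrix_vector_mul_linear_gen, of A l] by simp
  moreover have "vec.subspace ((*v) A ` l)"
    by (rule vec.subspace_image[OF l(1)])
  ultimately show ?thesis by (simp add: A(2) pgl_act_coset[OF l(1)] planes_def)
qed

lemma pgl_act_mono: "V \<subseteq> W \<Longrightarrow> pgl_act g V \<subseteq> pgl_act g W"
  by (auto simp: pgl_act_def)

lemma span_pair_in_planes:
  assumes "v \<noteq> 0" "u \<notin> vec.span {v}"
  shows "vec.span {u, v} \<in> (planes :: ('k::field ^ 3) set set)"
proof -
  have "vec.independent {u, v}" using assms by (simp add: vec.independent_insert)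
  then have "vec.dim {u, v} = card {u, v}" by (rule vec.dim_eq_card_independent)
  also have "card {u, v} = 2" using assms(2) vec.span_base[of v "{v}"] by (cases "u = v") auto
  finally show ?thesis by (simp only: planes_def vec.dim_span) simp
qed

text \<open>Adjoining to a representative \<open>v\<close> either of the two axes other than one
  where \<open>v\<close> is nonzero gives different planes. They supply distinct points of the
  blown-up space over \<open>z0\<close>.\<close>

lemma two_planes_through:
  fixes z :: "('k::{field, topological_space} ^ 3) set"
  assumes "z \<in> proj_plane"
  obtains l m where "l \<in> planes_through z" "m \<in> planes_through z" "l \<noteq> m"
proof -
  obtain v where v: "v \<noteq> 0" "z = vec.span {v}" using assms by (rule proj_plane_cases)
  then obtain i where i: "v $ i \<noteq> 0" by (auto simp: vec_eq_iff)
  obtain j k where jk: "j \<noteq> i" "k \<noteq> i" "j \<noteq> k"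
    using exhaust_3[of i] that[of 1 2] that[of 1 3] that[of 2 3] by auto
  define P where "P r = vec.span {axis r 1, v}" for r
  have P: "P r \<in> planes_through z" if "r \<noteq> i" for r
  proof -
    have "axis r 1 \<notin> vec.span {v}"
    proof
      assume "axis r 1 \<in> vec.span {v}"
      then obtain c where c: "axis r 1 = c *s v" by (auto simp: vec.span_singleton)
      then have "axis r 1 $ i = c * v $ i" by simp
      then have "c = 0" using that i by (simp add: axis_def)
      then have "axis r (1 :: 'k) $ r = 0" using c by simp
      then show False by (simp add: axis_def)
    qed
    then have "P r \<in> planes" unfolding P_def by (intro span_pair_in_planes v)
    moreover have "z \<subseteq> P r" unfolding P_def v(2) by (intro vec.span_mono) auto
    ultimately show ?thesis by (simp add: planes_through_def)
  qed
  \<comment> \<open>In a supposed combination of \<open>axis j 1\<close> and \<open>v\<close>,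
    coordinate \<open>i\<close> kills the multiple of \<open>v\<close>, and coordinate
    \<open>k\<close> then gives 1 = 0.\<close>
  have "axis k 1 \<notin> P j"
  proof
    assume "axis k 1 \<in> P j"
    then obtain c d where cd: "axis k 1 - c *s axis j 1 = d *s v"
      by (auto simp: P_def vec.span_breakdown_eq vec.span_singleton)
    then have "(axis k 1 - c *s axis j 1) $ i = d * v $ i" by simp
    then have "d = 0" using jk i by (simp add: axis_def)
    then have "(axis k 1 - c *s axis j 1) $ k = 0" using cd by simp
    then show False using jk by (simp add: axis_def)
  qed
  moreover have "axis k 1 \<in> P k" by (simp add: P_def vec.span_base)
  ultimately have "P j \<noteq> P k" by blast
  then show thesis using that P jk by blast
qed

text \<open>Distinct points span a plane together; over \<open>z\<close> itself any plane through
  \<open>z\<close> will do. This gives surjectivity of the projection and fills the free components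
  of points of the blown-up space.\<close>

lemma blowup_fibre_nonempty:
  fixes w z :: "('k::{field, topological_space} ^ 3) set"
  assumes w: "w \<in> proj_plane" and z: "z \<in> proj_plane"
  obtains l where "(w, l) \<in> blowup z"
proof (cases "w = z")
  case True
  obtain l where "l \<in> planes_through z" using two_planes_through[OF z] by blast
  then show thesis using that[of l] True w by (simp add: blowup_def planes_through_def)
next
  case False
  obtain u where u: "w = vec.span {u}" using w by (rule proj_plane_cases)
  obtain v where v: "v \<noteq> 0" "z = vec.span {v}" using z by (rule proj_plane_cases)
  have "u \<notin> vec.span {v}"
  proof
    assume "u \<in> vec.span {v}"
    then have "w \<subseteq> z" unfolding u v(2) by (intro vec.span_minimal) auto
    then show False using False w z vec.subspace_dim_equal[of w z] by (simp add: proj_plane_def)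
  qed
  then have "vec.span {u, v} \<in> planes" using v(1) by (intro span_pair_in_planes)
  moreover have "w \<subseteq> vec.span {u, v}" "z \<subseteq> vec.span {u, v}"
    unfolding u v(2) by (intro vec.span_mono; simp)+
  ultimately show thesis using that w by (auto simp: blowup_def planes_through_def)
qed

section \<open>The blown-up space and its action\<close>

lemma orbit_subset_proj_plane:
  fixes z0 :: "('k::{field, topological_space} ^ 3) set"
  assumes "subgroup \<Gamma> PGL3" "z0 \<in> proj_plane"
  shows "orbit \<Gamma> z0 \<subseteq> proj_plane"
  using pgl_act_proj_plane[OF subgroup.mem_carrier[OF assms(1)] assms(2)] by (auto simp: orbit_def)

lemma orbit_self:
  assumes "subgroup \<Gamma> PGL3" "z0 \<in> proj_plane"
  shows "z0 \<in> orbit \<Gamma> z0"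
  using subgroup.one_closed[OF assms(1)] pgl_act_one[of z0] assms(2)
  by (force simp: orbit_def proj_plane_def)

lemma orbit_act:
  assumes "subgroup \<Gamma> PGL3" "\<gamma> \<in> \<Gamma>" "z \<in> orbit \<Gamma> z0"
  shows "pgl_act \<gamma> z \<in> orbit \<Gamma> z0"
  using assms subgroup.m_closed[OF assms(1,2)] by (auto simp: orbit_def pgl_act_pgl_act)

lemma pgl_act_blowup:
  fixes z :: "('k::{field, topological_space} ^ 3) set"
  assumes "g \<in> carrier PGL3" "x \<in> blowup z"
  shows "map_prod (pgl_act g) (pgl_act g) x \<in> blowup (pgl_act g z)"
  using assms pgl_act_proj_plane[OF assms(1)] pgl_act_planes[OF assms(1)]
    pgl_act_mono[THEN subsetD]
  by (auto simp: blowup_def planes_through_def)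

lemma hat_space_blowup: "x \<in> hat_space \<Gamma> z0 \<Longrightarrow> z \<in> orbit \<Gamma> z0 \<Longrightarrow> x z \<in> blowup z"
  unfolding hat_space_def by blast

lemma hat_space_fst_eq:
  "x \<in> hat_space \<Gamma> z0 \<Longrightarrow> y \<in> orbit \<Gamma> z0 \<Longrightarrow> z \<in> orbit \<Gamma> z0 \<Longrightarrow> fst (x z) = fst (x y)"
  unfolding hat_space_def by blast

lemma
  fixes z0 :: "('k::{field, topological_space} ^ 3) set"
  assumes \<Gamma>: "subgroup \<Gamma> PGL3" and z0: "z0 \<in> proj_plane" and \<gamma>: "\<gamma> \<in> \<Gamma>" and x: "x \<in> hat_space \<Gamma> z0"
  shows hat_act_closed: "hat_act \<Gamma> z0 \<gamma> x \<in> hat_space \<Gamma> z0"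
    and hat_proj_hat_act: "hat_proj z0 (hat_act \<Gamma> z0 \<gamma> x) = pgl_act \<gamma> (hat_proj z0 x)"
proof -
  interpret PGL: group "PGL3 :: ('k ^ 3 ^ 3) set monoid" by (rule group_PGL3)
  interpret subgroup \<Gamma> PGL3 by (rule \<Gamma>)
  \<comment> \<open>Every index is a translate of an index by \<open>\<gamma>\<close>, so
    \<open>hat_act_apply\<close> describes all components of the image.\<close>
  have translate: "\<exists>z'\<in>orbit \<Gamma> z0. z = pgl_act \<gamma> z'" if z: "z \<in> orbit \<Gamma> z0" for z
  proof
    show "pgl_act (inv\<^bsub>PGL3\<^esub> \<gamma>) z \<in> orbit \<Gamma> z0" using z \<gamma> by (intro orbit_act[OF \<Gamma>]) auto
    have "vec.subspace z" using z orbit_subset_proj_plane[OF \<Gamma> z0] by (auto simp: proj_plane_def)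
    then show "z = pgl_act \<gamma> (pgl_act (inv\<^bsub>PGL3\<^esub> \<gamma>) z)"
      using \<gamma> by (simp add: pgl_act_pgl_act pgl_act_one)
  qed
  have fst: "fst (hat_act \<Gamma> z0 \<gamma> x z) = pgl_act \<gamma> (hat_proj z0 x)"
    and blowup: "hat_act \<Gamma> z0 \<gamma> x z \<in> blowup z" if z: "z \<in> orbit \<Gamma> z0" for z
  proof -
    obtain z' where z': "z' \<in> orbit \<Gamma> z0" "z = pgl_act \<gamma> z'" using translate[OF z] by blast
    have eq: "hat_act \<Gamma> z0 \<gamma> x z = map_prod (pgl_act \<gamma>) (pgl_act \<gamma>) (x z')"
      unfolding z'(2) by (rule hat_act_apply[OF \<Gamma> z0 \<gamma> z'(1)])
    have "fst (x z') = fst (x z0)" "x z' \<in> blowup z'"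
      using hat_space_fst_eq[OF x orbit_self[OF \<Gamma> z0] z'(1)] hat_space_blowup[OF x z'(1)] .
    then show "fst (hat_act \<Gamma> z0 \<gamma> x z) = pgl_act \<gamma> (hat_proj z0 x)"
      "hat_act \<Gamma> z0 \<gamma> x z \<in> blowup z"
      using pgl_act_blowup[OF mem_carrier[OF \<gamma>]] by (simp_all add: eq hat_proj_def) (simp add: z'(2))
  qed
  then show "hat_act \<Gamma> z0 \<gamma> x \<in> hat_space \<Gamma> z0"
    by (auto simp: hat_space_def hat_act_def)
  show "hat_proj z0 (hat_act \<Gamma> z0 \<gamma> x) = pgl_act \<gamma> (hat_proj z0 x)"
    using fst[OF orbit_self[OF \<Gamma> z0]] by (simp add: hat_proj_def)
qed

lemma continuous_map_hat_proj:
  assumes "subgroup \<Gamma> PGL3" "z0 \<in> proj_plane"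
  shows "continuous_map (hat_topology \<Gamma> z0) proj_topology (hat_proj z0)"
proof -
  have "continuous_map (hat_topology \<Gamma> z0) (blowup_topology z0) (\<lambda>x. x z0)"
    unfolding hat_topology_def
    by (intro continuous_map_from_subtopology continuous_map_product_projection orbit_self assms)
  moreover have "continuous_map (blowup_topology z0) proj_topology fst"
    unfolding blowup_topology_def by (intro continuous_map_from_subtopology continuous_map_fst)
  ultimately have "continuous_map (hat_topology \<Gamma> z0) proj_topology (fst \<circ> (\<lambda>x. x z0))"
    by (rule continuous_map_compose)
  then show ?thesis by (simp add: hat_proj_def[abs_def] o_def)
qed

text \<open>The component at \<open>z0\<close> may be prescribed freely: the others need only lie
  over the same point \<open>w\<close>, and each blowup has a nonempty fibre there.\<close>

lemma hat_proj_fibre: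
  fixes z0 :: "('k::{field, topological_space} ^ 3) set"
  assumes \<Gamma>: "subgroup \<Gamma> PGL3" and z0: "z0 \<in> proj_plane" and x0: "x0 \<in> blowup z0"
  obtains x where "x \<in> hat_space \<Gamma> z0" "x z0 = x0"
proof -
  define w where "w = fst x0"
  have w: "w \<in> proj_plane" using x0 by (auto simp: blowup_def w_def)
  have "\<forall>z\<in>orbit \<Gamma> z0. \<exists>l. (w, l) \<in> blowup z"
    using orbit_subset_proj_plane[OF \<Gamma> z0] blowup_fibre_nonempty[OF w] by (metis subsetD)
  then obtain l where l: "\<And>z. z \<in> orbit \<Gamma> z0 \<Longrightarrow> (w, l z) \<in> blowup z" by metis
  define x where "x = (\<lambda>z\<in>orbit \<Gamma> z0. if z = z0 then x0 else (w, l z))"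
  have "x \<in> hat_space \<Gamma> z0" using l x0 by (auto simp: x_def hat_space_def w_def)
  moreover have "x z0 = x0" using orbit_self[OF \<Gamma> z0] by (simp add: x_def)
  ultimately show thesis using that by blast
qed

section \<open>Non-conjugacy of the standard and the perturbed action\<close>

theorem proposition7p3:
  fixes \<Gamma> :: "('p::prime_card padic ^ 3 ^ 3) set set"
    and z0 :: "('p padic ^ 3) set"
    and d :: "('p padic ^ 3) set \<Rightarrow> ('p padic ^ 3) set \<Rightarrow> real"
    and h :: "real \<Rightarrow> (('p padic ^ 3) set \<Rightarrow> ('p padic ^ 3) set \<times> ('p padic ^ 3) set)
              \<Rightarrow> ('p padic ^ 3) set"
  assumes lattice: "uniform_lattice PGL3 PGL3_topology \<Gamma>"
    and z0: "z0 \<in> proj_plane"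
    and trivial_stabilizer: "\<forall>\<gamma>\<in>\<Gamma>. pgl_act \<gamma> z0 = z0 \<longrightarrow> \<gamma> = \<one>\<^bsub>PGL3\<^esub>"
    and metric: "Metric_space proj_plane d"
    and compatible: "Metric_space.mtopology proj_plane d = proj_topology"
    and h_homeo: "\<And>\<epsilon>. \<epsilon> > 0 \<Longrightarrow> homeomorphic_map (hat_topology \<Gamma> z0) proj_topology (h \<epsilon>)"
    and h_close: "\<And>\<epsilon> x. \<epsilon> > 0 \<Longrightarrow> x \<in> hat_space \<Gamma> z0 \<Longrightarrow> d (h \<epsilon> x) (hat_proj z0 x) < \<epsilon>"
  shows "\<not> (\<exists>\<epsilon>>0. conjugate_actions proj_topology \<Gamma> pgl_act (perturbed_act \<Gamma> z0 (h \<epsilon>)))"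
proof
  assume "\<exists>\<epsilon>>0. conjugate_actions proj_topology \<Gamma> pgl_act (perturbed_act \<Gamma> z0 (h \<epsilon>))"
  then obtain \<epsilon> f where \<epsilon>: "\<epsilon> > 0" and f: "homeomorphic_map proj_topology proj_topology f"
    and conj: "\<And>\<gamma> w. \<gamma> \<in> \<Gamma> \<Longrightarrow> w \<in> proj_plane \<Longrightarrow>
      f (perturbed_act \<Gamma> z0 (h \<epsilon>) \<gamma> w) = pgl_act \<gamma> (f w)"
    by (auto simp: conjugate_actions_def)
  have \<Gamma>: "subgroup \<Gamma> PGL3"
    and compact: "compact_space (quotient_topology PGL3_topology (\<lambda>g. g <#\<^bsub>PGL3\<^esub> \<Gamma>))"
    using lattice by (auto simp: uniform_lattice_def)
  have h: "homeomorphic_map (hat_topology \<Gamma> z0) proj_topology (h \<epsilon>)" by (rule h_homeo[OF \<epsilon>])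
  define F where "F = f \<circ> h \<epsilon>"
  have F: "homeomorphic_map (hat_topology \<Gamma> z0) proj_topology F"
    unfolding F_def using h f by (rule homeomorphic_map_compose)
  have F_equi: "F (hat_act \<Gamma> z0 \<gamma> x) = pgl_act \<gamma> (F x)" if "\<gamma> \<in> \<Gamma>" "x \<in> hat_space \<Gamma> z0" for \<gamma> x
  proof -
    \<comment> \<open>Injectivity cancels the \<open>inv_into\<close> inside
      \<open>perturbed_act\<close>, so \<open>F\<close> intertwines the action on the blown-up space
      with the standard one.\<close>
    have "inj_on (h \<epsilon>) (hat_space \<Gamma> z0)" "h \<epsilon> x \<in> proj_plane"
      using homeomorphic_imp_injective_map[OF h] homeomorphic_imp_surjective_map[OF h] that(2) by auto
    then show ?thesis
      using conj[OF that(1), of "h \<epsilon> x"] that(2) by (simp add: perturbed_act_def F_def)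
  qed
  obtain E where E: "homeomorphic_maps (hat_topology \<Gamma> z0) proj_topology F E"
    using F by (auto simp: homeomorphic_map_maps)
  then have EF: "E (F x) = x" if "x \<in> hat_space \<Gamma> z0" for x
    using that by (simp add: homeomorphic_maps_def)
  have F_hat: "F ` hat_space \<Gamma> z0 = proj_plane"
    using homeomorphic_imp_surjective_map[OF F] by simp
  define G where "G = hat_proj z0 \<circ> E"
  have G_F: "G (F x) = hat_proj z0 x" if "x \<in> hat_space \<Gamma> z0" for x
    using EF[OF that] by (simp add: G_def)
  have "G w = w" if "w \<in> proj_plane" for w
  proof (rule cocompact_equivariant_eq_id[OF \<Gamma> compact _ _ _ _ that])
    show "Hausdorff_space (proj_topology :: ('p padic ^ 3) set topology)"
      using Metric_space.Hausdorff_space_mtopology[OF metric] compatible by simp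
    show "continuous_map proj_topology proj_topology G"
      unfolding G_def using E continuous_map_hat_proj[OF \<Gamma> z0]
      by (auto simp: homeomorphic_maps_def intro: continuous_map_compose)
    have "hat_proj z0 ` hat_space \<Gamma> z0 = proj_plane"
    proof (intro equalityI subsetI)
      fix w assume "w \<in> hat_proj z0 ` hat_space \<Gamma> z0"
      then obtain x where x: "x \<in> hat_space \<Gamma> z0" "w = hat_proj z0 x" by blast
      show "w \<in> proj_plane"
        using hat_space_blowup[OF x(1) orbit_self[OF \<Gamma> z0]] by (auto simp: x(2) hat_proj_def blowup_def)
    next
      fix w :: "('p padic ^ 3) set" assume "w \<in> proj_plane"
      then obtain l where "(w, l) \<in> blowup z0" using blowup_fibre_nonempty[OF _ z0] by blast
      then obtain x where "x \<in> hat_space \<Gamma> z0" "x z0 = (w, l)" by (rule hat_proj_fibre[OF \<Gamma> z0])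
      then show "w \<in> hat_proj z0 ` hat_space \<Gamma> z0" by (force simp: hat_proj_def)
    qed
    then show "G ` proj_plane = proj_plane"
      unfolding F_hat[symmetric] image_image by (simp add: G_F)
    show "G (pgl_act \<gamma> w) = pgl_act \<gamma> (G w)" if \<gamma>: "\<gamma> \<in> \<Gamma>" and w: "w \<in> proj_plane" for \<gamma> w
    proof -
      obtain x where x: "x \<in> hat_space \<Gamma> z0" "w = F x" using w F_hat by auto
      show ?thesis
        using hat_act_closed[OF \<Gamma> z0 \<gamma> x(1)] hat_proj_hat_act[OF \<Gamma> z0 \<gamma> x(1)] x
        by (simp add: G_F flip: F_equi[OF \<gamma>])
    qed
  qed
  \<comment> \<open>As \<open>G\<close> is the identity, the homeomorphism \<open>F\<close>
    coincides with the projection, which is not injective over \<open>z0\<close>.\<close>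
  then have F_eq: "F x = hat_proj z0 x" if "x \<in> hat_space \<Gamma> z0" for x
    using G_F[OF that] F_hat that by fastforce
  obtain l m where lm: "l \<in> planes_through z0" "m \<in> planes_through z0" "l \<noteq> m"
    using two_planes_through[OF z0] by blast
  have "(z0, l) \<in> blowup z0" "(z0, m) \<in> blowup z0"
    using lm z0 by (auto simp: blowup_def planes_through_def)
  then obtain x y where xy: "x \<in> hat_space \<Gamma> z0" "x z0 = (z0, l)" "y \<in> hat_space \<Gamma> z0" "y z0 = (z0, m)"
    using hat_proj_fibre[OF \<Gamma> z0] by metis
  have "F x = F y" using F_eq xy by (simp add: hat_proj_def)
  then have "x = y" using EF xy by metis
  then show False using xy lm(3) by simp
qed

end
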